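(* Let $Z$ be a topological space. The following statements are equivalent: (i) $Z$ is up-spectral. (ii) $Z$ is almost-spectral.
   Context: An irreducible closed set is a non-empty closed set $F$ such that $F=G\cup H$ with $G,H$ closed implies $F=G$ or $F=H$. A space is sober if every irreducible closed set is the closure of a unique point. A space is coherent if it has a basis of open compact sets that is closed under finite (non-empty) intersections (compactness does not include Hausdorff). A space is up-spectral if it is coherent and sober. A space is almost-spectral if it is homeomorphic to the prime spectrum of a commutative ring $A$ not necessarily having an identity, i.e. the set of prime ideals of $A$ (proper ideals $P$ with $ab\in P\Rightarrow a\in P$ or $b\in P$) with the Zariski topology, whose basic open sets are $D(a)=\{P : a\notin P\}$, $a\in A$. *)

theory Defs
  imports "HOL-Analysis.Abstract_Topology" "HOL-Algebra.Ideal"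
begin

section \<open>Up-spectral spaces\<close>

definition irreducible_closed :: "'a topology \<Rightarrow> 'a set \<Rightarrow> bool" where
  "irreducible_closed X F \<longleftrightarrow>
     closedin X F \<and> F \<noteq> {} \<and>
     (\<forall>G H. closedin X G \<and> closedin X H \<and> F = G \<union> H \<longrightarrow> F = G \<or> F = H)"

definition sober :: "'a topology \<Rightarrow> bool" where
  "sober X \<longleftrightarrow>
     (\<forall>F. irreducible_closed X F \<longrightarrow> (\<exists>!x. x \<in> topspace X \<and> F = X closure_of {x}))"

text \<open>Only intersections of non-empty families are required, so \<^term>\<open>X\<close> itself
  need not be compact; \<^const>\<open>compactin\<close> involves no separation axiom.\<close>

definition coherent :: "'a topology \<Rightarrow> bool" where
  "coherent X \<longleftrightarrow>
     (\<exists>\<B>. openin X = arbitrary union_of (\<lambda>U. U \<in> \<B>) \<and>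
          (\<forall>U\<in>\<B>. openin X U \<and> compactin X U) \<and>
          (\<forall>\<F>\<subseteq>\<B>. finite \<F> \<and> \<F> \<noteq> {} \<longrightarrow> \<Inter>\<F> \<in> \<B>))"

definition up_spectral :: "'a topology \<Rightarrow> bool" where
  "up_spectral X \<longleftrightarrow> coherent X \<and> sober X"

section \<open>Prime spectra of commutative rings not necessarily having an identity\<close>

text \<open>The locale \<^locale>\<open>cring\<close> and the locale \<^locale>\<open>ideal\<close> require an identity.
  The locale below uses the same records, but the field \<open>one\<close> is left unconstrained
  and is never used.\<close>

locale comm_rng = abelian_group R for R (structure) +
  assumes m_closed: "\<lbrakk>a \<in> carrier R; b \<in> carrier R\<rbrakk> \<Longrightarrow> a \<otimes> b \<in> carrier R"
    and m_assoc: "\<lbrakk>a \<in> carrier R; b \<in> carrier R; c \<in> carrier R\<rbrakk>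
                    \<Longrightarrow> (a \<otimes> b) \<otimes> c = a \<otimes> (b \<otimes> c)"
    and m_comm: "\<lbrakk>a \<in> carrier R; b \<in> carrier R\<rbrakk> \<Longrightarrow> a \<otimes> b = b \<otimes> a"
    and l_distr: "\<lbrakk>a \<in> carrier R; b \<in> carrier R; c \<in> carrier R\<rbrakk>
                    \<Longrightarrow> (a \<oplus> b) \<otimes> c = a \<otimes> c \<oplus> b \<otimes> c"

definition rng_ideal :: "('r, 'm) ring_scheme \<Rightarrow> 'r set \<Rightarrow> bool" where
  "rng_ideal R I \<longleftrightarrow>
     additive_subgroup I R \<and> (\<forall>a\<in>I. \<forall>x\<in>carrier R. x \<otimes>\<^bsub>R\<^esub> a \<in> I)"

definition rng_prime_ideal :: "('r, 'm) ring_scheme \<Rightarrow> 'r set \<Rightarrow> bool" where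
  "rng_prime_ideal R P \<longleftrightarrow>
     rng_ideal R P \<and> P \<noteq> carrier R \<and>
     (\<forall>a\<in>carrier R. \<forall>b\<in>carrier R. a \<otimes>\<^bsub>R\<^esub> b \<in> P \<longrightarrow> a \<in> P \<or> b \<in> P)"

definition basic_open :: "('r, 'm) ring_scheme \<Rightarrow> 'r \<Rightarrow> 'r set set" where
  "basic_open R a = {P. rng_prime_ideal R P \<and> a \<notin> P}"

definition prime_spectrum :: "('r, 'm) ring_scheme \<Rightarrow> 'r set topology" where
  "prime_spectrum R =
     topology (arbitrary union_of (\<lambda>U. \<exists>a\<in>carrier R. U = basic_open R a))"

text \<open>Consistency with the library notions for rings with identity.\<close>

lemma cring_imp_comm_rng: "cring R \<Longrightarrow> comm_rng R"
  by (intro comm_rng.intro comm_rng_axioms.intro)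
    (auto simp: cring.cring_simprules intro: cring.axioms ring.is_abelian_group)

lemma (in cring) rng_ideal_iff_ideal: "rng_ideal R I \<longleftrightarrow> ideal I R"
proof
  assume I: "rng_ideal R I"
  have "I \<subseteq> carrier R"
    using I additive_subgroup.a_subset unfolding rng_ideal_def by blast
  then show "ideal I R"
    using I unfolding rng_ideal_def
    by (auto intro!: ideal.intro ideal_axioms.intro ring_axioms simp: m_comm subset_iff)
next
  assume "ideal I R"
  then show "rng_ideal R I"
    by (simp add: rng_ideal_def ideal.axioms(1) ideal.I_l_closed)
qed

lemma (in cring) rng_prime_ideal_iff_primeideal: "rng_prime_ideal R P \<longleftrightarrow> primeideal P R"
  unfolding rng_prime_ideal_def rng_ideal_iff_ideal primeideal_def primeideal_axioms_def
  using is_cring by blast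

text \<open>The basic open sets indeed form a basis of a topology on the set of prime ideals.\<close>

lemma (in comm_rng) basic_open_mult:
  assumes a: "a \<in> carrier R" and b: "b \<in> carrier R"
  shows "basic_open R (a \<otimes> b) = basic_open R a \<inter> basic_open R b"
proof -
  have "a \<otimes> b \<in> P \<longleftrightarrow> a \<in> P \<or> b \<in> P" if P: "rng_prime_ideal R P" for P
  proof
    show "a \<otimes> b \<in> P \<Longrightarrow> a \<in> P \<or> b \<in> P"
      using P a b by (simp add: rng_prime_ideal_def)
  next
    have absorb: "x \<otimes> y \<in> P" if "x \<in> carrier R" "y \<in> P" for x y
      using P that by (simp add: rng_prime_ideal_def rng_ideal_def)
    show "a \<in> P \<or> b \<in> P \<Longrightarrow> a \<otimes> b \<in> P"
      using absorb[OF a, of b] absorb[OF b, of a] m_comm[OF a b] by auto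
  qed
  then show ?thesis
    unfolding basic_open_def by blast
qed

lemma (in comm_rng) openin_prime_spectrum:
  "openin (prime_spectrum R) =
     arbitrary union_of (\<lambda>U. \<exists>a\<in>carrier R. U = basic_open R a)"
  unfolding prime_spectrum_def
proof (intro topology_inverse' istopology_base)
  fix S T
  assume "\<exists>a\<in>carrier R. S = basic_open R a" "\<exists>a\<in>carrier R. T = basic_open R a"
  then obtain a b where "a \<in> carrier R" "b \<in> carrier R"
    "S = basic_open R a" "T = basic_open R b"
    by auto
  then show "\<exists>c\<in>carrier R. S \<inter> T = basic_open R c"
    by (intro bexI[of _ "a \<otimes> b"]) (simp_all add: basic_open_mult m_closed)
qed

lemma (in comm_rng) topspace_prime_spectrum:
  "topspace (prime_spectrum R) = {P. rng_prime_ideal R P}"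
proof
  have "U \<subseteq> {P. rng_prime_ideal R P}" if "openin (prime_spectrum R) U" for U
    using that unfolding openin_prime_spectrum union_of_def basic_open_def by auto
  from this[OF openin_topspace]
  show "topspace (prime_spectrum R) \<subseteq> {P. rng_prime_ideal R P}" .
next
  show "{P. rng_prime_ideal R P} \<subseteq> topspace (prime_spectrum R)"
  proof
    fix P
    assume "P \<in> {P. rng_prime_ideal R P}"
    then have P: "rng_prime_ideal R P"
      by simp
    then have "P \<subseteq> carrier R" "P \<noteq> carrier R"
      using additive_subgroup.a_subset unfolding rng_prime_ideal_def rng_ideal_def by auto
    then obtain a where a: "a \<in> carrier R" "a \<notin> P"
      by auto
    have "openin (prime_spectrum R) (basic_open R a)"
      unfolding openin_prime_spectrum by (rule union_of_inc) (use a in \<open>auto simp: arbitrary_def\<close>)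
    moreover have "P \<in> basic_open R a"
      using P a by (simp add: basic_open_def)
    ultimately show "P \<in> topspace (prime_spectrum R)"
      using openin_subset by blast
  qed
qed

section \<open>Almost-spectral spaces\<close>

text \<open>One cannot quantify over types inside a formula, so the type of the elements of the
  ring is a parameter of the definition.\<close>

definition almost_spectral :: "'r itself \<Rightarrow> 'a topology \<Rightarrow> bool" where
  "almost_spectral _ X \<longleftrightarrow>
     (\<exists>A :: 'r ring. comm_rng A \<and> X homeomorphic_space prime_spectrum A)"

text \<open>A fixed type of ring elements that is large enough, in terms of the type of the points,
  to accommodate (up to isomorphism) every ring needed to represent a space on these points:
  it is infinite, and its cardinality is \<open>2 ^ 2 ^ max (\<aleph>\<^sub>0, \<bar>'a\<bar>)\<close>.\<close>

type_synonym 'a large = "('a + nat) set set"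

end

theory Submission
  imports Defs "HOL-Library.Countable" "HOL-Library.Poly_Mapping"
    "HOL-Computational_Algebra.Fraction_Field"
begin

text \<open>For a rng \<open>R\<close>, compactness of \<open>D(a)\<close> follows by separating the multiplicative set
  \<open>{x. D(a) \<subseteq> D(x)}\<close> from the ideal of all \<open>x\<close> whose \<open>D(x)\<close> has a finite subcover, and the
  generic point of an irreducible closed set \<open>F\<close> is \<open>\<Inter>F\<close>.

  For the converse let \<open>k\<close> be the field of rational functions in indeterminates \<open>T U\<close>, one for
  each set \<open>U\<close> of points. A point \<open>p\<close> determines the subfield \<open>K p\<close> generated by the \<open>T U\<close> with
  \<open>p \<in> U\<close> and the valuation \<open>v p\<close> given by the degree in the remaining indeterminates, which is
  trivial on \<open>K p\<close>. The ring consists of the constructible functions \<open>f : Z \<rightarrow> k\<close> with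
  \<open>f p \<in> K p\<close> and \<open>v p (f x - f p) > 0\<close> for all \<open>x\<close> near \<open>p\<close>. The supports of such functions
  are open and compact, and every compact open \<open>U\<close> is the support of \<open>T U\<close> restricted to \<open>U\<close>.
  If \<open>a\<close> vanishes wherever \<open>b\<close> does, then \<open>a ^ n / b\<close> is again such a function for large \<open>n\<close>,
  because \<open>v p (b x)\<close> is bounded; so \<open>a\<close> lies in every prime ideal that contains \<open>b\<close>. Moreover
  \<open>a\<^sup>2 + T W b\<^sup>2\<close> vanishes on \<open>W\<close> only where both \<open>a\<close> and \<open>b\<close> do. Hence a prime ideal is
  determined by its zero set, which is irreducible and closed, and it is the ideal of all functions
  vanishing at the generic point.\<close>

section \<open>Prime spectra are up-spectral\<close>

context comm_rng
begin

section \<open>Ideals of commutative rngs and existence of primes\<close>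

lemma l_null: assumes "x \<in> carrier R" shows "\<zero> \<otimes> x = \<zero>"
proof -
  have "\<zero> \<otimes> x \<oplus> \<zero> \<otimes> x = \<zero> \<otimes> x \<oplus> \<zero>"
    using assms l_distr[of \<zero> \<zero> x] by (simp add: m_closed)
  then show ?thesis
    using assms by (simp add: m_closed)
qed

lemma l_minus:
  assumes "a \<in> carrier R" "x \<in> carrier R" shows "(\<ominus> a) \<otimes> x = \<ominus> (a \<otimes> x)"
proof -
  have "(\<ominus> a) \<otimes> x \<oplus> a \<otimes> x = \<zero>"
    using assms l_distr[of "\<ominus> a" a x] by (simp add: l_neg l_null)
  then show ?thesis
    using assms by (simp add: m_closed minus_equality)
qed

lemma rng_idealI:
  assumes "I \<subseteq> carrier R" "\<zero> \<in> I" "\<And>a b. a \<in> I \<Longrightarrow> b \<in> I \<Longrightarrow> a \<oplus> b \<in> I"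
    "\<And>a. a \<in> I \<Longrightarrow> \<ominus> a \<in> I" "\<And>a x. a \<in> I \<Longrightarrow> x \<in> carrier R \<Longrightarrow> x \<otimes> a \<in> I"
  shows "rng_ideal R I"
  unfolding rng_ideal_def
  using assms by (auto intro!: additive_subgroup.intro subgroup.intro simp: a_inv_def)

lemma rng_idealD:
  assumes "rng_ideal R I"
  shows "I \<subseteq> carrier R" "\<zero> \<in> I" "\<And>a b. a \<in> I \<Longrightarrow> b \<in> I \<Longrightarrow> a \<oplus> b \<in> I"
    "\<And>a. a \<in> I \<Longrightarrow> \<ominus> a \<in> I" "\<And>a x. a \<in> I \<Longrightarrow> x \<in> carrier R \<Longrightarrow> x \<otimes> a \<in> I"
    "\<And>a x. a \<in> I \<Longrightarrow> x \<in> carrier R \<Longrightarrow> a \<otimes> x \<in> I"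
proof -
  interpret additive_subgroup I R
    using assms by (simp add: rng_ideal_def)
  show sub: "I \<subseteq> carrier R" "\<zero> \<in> I" "\<And>a b. a \<in> I \<Longrightarrow> b \<in> I \<Longrightarrow> a \<oplus> b \<in> I"
    by (auto simp: a_subset)
  show "\<And>a. a \<in> I \<Longrightarrow> \<ominus> a \<in> I"
    using a_subgroup subgroup.m_inv_closed by (fastforce simp: a_inv_def)
  show l: "\<And>a x. a \<in> I \<Longrightarrow> x \<in> carrier R \<Longrightarrow> x \<otimes> a \<in> I"
    using assms by (simp add: rng_ideal_def)
  show "\<And>a x. a \<in> I \<Longrightarrow> x \<in> carrier R \<Longrightarrow> a \<otimes> x \<in> I"
    using l sub(1) by (metis m_comm subsetD)
qed

lemma rng_prime_idealD:
  assumes "rng_prime_ideal R P"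
  shows "rng_ideal R P" "P \<noteq> carrier R"
    "\<And>a b. a \<in> carrier R \<Longrightarrow> b \<in> carrier R \<Longrightarrow> a \<otimes> b \<in> P \<Longrightarrow> a \<in> P \<or> b \<in> P"
  using assms by (auto simp: rng_prime_ideal_def)

lemma rng_ideal_colon:
  assumes I: "rng_ideal R I" and x: "x \<in> carrier R"
  shows "rng_ideal R {r \<in> carrier R. r \<otimes> x \<in> I}"
proof (rule rng_idealI)
  fix a r assume "a \<in> {r \<in> carrier R. r \<otimes> x \<in> I}" "r \<in> carrier R"
  then show "r \<otimes> a \<in> {r \<in> carrier R. r \<otimes> x \<in> I}"
    using x rng_idealD(5)[OF I, of "a \<otimes> x" r] by (simp add: m_closed m_assoc)
qed (use x rng_idealD[OF I] in \<open>auto simp: l_null l_distr l_minus\<close>)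

lemma subset_colon:
  assumes "rng_ideal R I" "x \<in> carrier R"
  shows "I \<subseteq> {r \<in> carrier R. r \<otimes> x \<in> I}"
  using rng_idealD(1,6)[OF assms(1)] assms(2) by blast

text \<open>Ideals of the form \<open>(P : x)\<close> replace the sums \<open>P + (x)\<close> of the classical argument, which
  are awkward without an identity.\<close>

lemma ex_rng_prime_ideal_disjoint:
  assumes J: "rng_ideal R J" and M: "M \<noteq> {}" "M \<subseteq> carrier R"
    "\<And>a b. a \<in> M \<Longrightarrow> b \<in> M \<Longrightarrow> a \<otimes> b \<in> M" and disj: "J \<inter> M = {}"
  obtains P where "rng_prime_ideal R P" "J \<subseteq> P" "P \<inter> M = {}"
proof -
  let ?A = "{I. rng_ideal R I \<and> J \<subseteq> I \<and> I \<inter> M = {}}"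
  have "\<exists>P\<in>?A. \<forall>X\<in>?A. P \<subseteq> X \<longrightarrow> X = P"
  proof (rule subset_Zorn_nonempty)
    show "?A \<noteq> {}"
      using J disj by blast
  next
    fix \<C> assume C: "\<C> \<noteq> {}" "subset.chain ?A \<C>"
    then have id: "rng_ideal R I" if "I \<in> \<C>" for I
      using that by (auto simp: subset.chain_def)
    have lin: "I \<subseteq> I' \<or> I' \<subseteq> I" if "I \<in> \<C>" "I' \<in> \<C>" for I I'
      using that C(2) by (simp add: subset_chain_def)
    have "rng_ideal R (\<Union>\<C>)"
    proof (rule rng_idealI)
      fix a b assume "a \<in> \<Union>\<C>" "b \<in> \<Union>\<C>"
      then obtain I I' where I: "I \<in> \<C>" "a \<in> I" "I' \<in> \<C>" "b \<in> I'"
        by blast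
      then have "\<exists>I\<in>\<C>. a \<in> I \<and> b \<in> I"
        using lin[OF I(1,3)] by blast
      then show "a \<oplus> b \<in> \<Union>\<C>"
        using rng_idealD(3)[OF id] by blast
    next
      show "\<Union>\<C> \<subseteq> carrier R"
        using rng_idealD(1)[OF id] by blast
      show "\<zero> \<in> \<Union>\<C>"
        using rng_idealD(2)[OF id] C(1) by blast
    qed (use rng_idealD(4,5)[OF id] in blast)+
    then show "\<Union>\<C> \<in> ?A"
      using C by (auto simp: subset.chain_def)
  qed
  then obtain P where P: "rng_ideal R P" "J \<subseteq> P" "P \<inter> M = {}"
    and max: "\<And>I. rng_ideal R I \<Longrightarrow> P \<subseteq> I \<Longrightarrow> I \<inter> M = {} \<Longrightarrow> I = P"
    by (smt (verit) mem_Collect_eq subset_trans)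
  \<comment> \<open>The ideal \<open>(P : x)\<close> contains \<open>P\<close>, and strictly so
    because of \<open>y\<close>; maximality of \<open>P\<close> then forces it to meet
    \<open>M\<close>.\<close>
  have colon: "(\<exists>m\<in>M. m \<otimes> x \<in> P)" if "x \<in> carrier R" "y \<in> carrier R" "y \<notin> P" "y \<otimes> x \<in> P" for x y
    using max[OF rng_ideal_colon[OF P(1) that(1)] subset_colon[OF P(1) that(1)]] that by blast
  have "rng_prime_ideal R P"
    unfolding rng_prime_ideal_def
  proof (intro conjI ballI impI P(1))
    show "P \<noteq> carrier R"
      using P(3) M(1,2) by blast
  next
    fix x y assume xy: "x \<in> carrier R" "y \<in> carrier R" "x \<otimes> y \<in> P"
    show "x \<in> P \<or> y \<in> P"
    proof (rule ccontr)
      assume n: "\<not> (x \<in> P \<or> y \<in> P)"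
      \<comment> \<open>Two applications of \<open>colon\<close> replace first \<open>y\<close> and
        then \<open>x\<close> by elements of \<open>M\<close>, so that a product of two elements of
        \<open>M\<close> ends up in \<open>P\<close>.\<close>
      then obtain m where m: "m \<in> M" "m \<otimes> x \<in> P"
        using colon[of x y] xy by (auto simp: m_comm)
      then obtain m' where "m' \<in> M" "m' \<otimes> m \<in> P"
        using colon[of m x] n xy M(2) by (auto simp: m_comm)
      then show False
        using M(3) m(1) P(3) by blast
    qed
  qed
  then show ?thesis
    using that P by blast
qed

section \<open>Basic open sets, their compactness, and coherence\<close>

lemma openin_basic_open: "a \<in> carrier R \<Longrightarrow> openin (prime_spectrum R) (basic_open R a)"
  unfolding openin_prime_spectrum by (rule union_of_inc) (auto simp: arbitrary_def)

lemma prime_spectrum_openE: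
  assumes "openin (prime_spectrum R) U" "P \<in> U"
  obtains a where "a \<in> carrier R" "P \<in> basic_open R a" "basic_open R a \<subseteq> U"
proof -
  obtain \<U> where "\<U> \<subseteq> {U. \<exists>a\<in>carrier R. U = basic_open R a}" "\<Union>\<U> = U"
    using assms(1) unfolding openin_prime_spectrum union_of_def by blast
  then show ?thesis
    using that assms(2) by blast
qed

lemma basic_open_add_subset:
  assumes "a \<in> carrier R" "b \<in> carrier R"
  shows "basic_open R (a \<oplus> b) \<subseteq> basic_open R a \<union> basic_open R b"
  using rng_idealD(3) by (auto simp: basic_open_def rng_prime_ideal_def)

lemma basic_open_zero: "basic_open R \<zero> = {}"
  using rng_idealD(2) by (auto simp: basic_open_def rng_prime_ideal_def)

lemma basic_open_minus_subset:
  "a \<in> carrier R \<Longrightarrow> basic_open R (\<ominus> a) \<subseteq> basic_open R a"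
  using rng_idealD(4) by (auto simp: basic_open_def rng_prime_ideal_def)

lemma basic_open_finite_subcover:
  assumes a: "a \<in> carrier R" and S: "S \<subseteq> carrier R"
    and cover: "basic_open R a \<subseteq> (\<Union>b\<in>S. basic_open R b)"
  obtains F where "finite F" "F \<subseteq> S" "basic_open R a \<subseteq> (\<Union>b\<in>F. basic_open R b)"
proof -
  \<comment> \<open>A prime that contains \<open>J\<close> and avoids \<open>M\<close> lies in
    \<open>D(a)\<close>, since \<open>a\<close> is in \<open>M\<close>; hence it lies in some
    \<open>D(b)\<close> with \<open>b\<close> in \<open>S\<close>. But \<open>S\<close> is contained
    in \<open>J\<close>, a contradiction.\<close>
  define J where "J = {x \<in> carrier R. \<exists>F. finite F \<and> F \<subseteq> S \<and> basic_open R x \<subseteq> (\<Union>b\<in>F. basic_open R b)}"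
  define M where "M = {x \<in> carrier R. basic_open R a \<subseteq> basic_open R x}"
  have J: "rng_ideal R J"
  proof (rule rng_idealI)
    show "J \<subseteq> carrier R" by (auto simp: J_def)
    show "\<zero> \<in> J" by (auto simp: J_def basic_open_zero intro!: exI[of _ "{}"])
  next
    fix x y assume "x \<in> J" "y \<in> J"
    then obtain F G where F: "finite F" "F \<subseteq> S" "basic_open R x \<subseteq> (\<Union>b\<in>F. basic_open R b)"
      and G: "finite G" "G \<subseteq> S" "basic_open R y \<subseteq> (\<Union>b\<in>G. basic_open R b)"
      and xy: "x \<in> carrier R" "y \<in> carrier R"
      by (auto simp: J_def)
    have "basic_open R (x \<oplus> y) \<subseteq> (\<Union>b\<in>F \<union> G. basic_open R b)"
      using F(3) G(3) basic_open_add_subset[OF xy] by auto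
    then show "x \<oplus> y \<in> J"
      using F G xy by (auto simp: J_def intro!: exI[of _ "F \<union> G"])
  next
    fix x assume "x \<in> J"
    then show "\<ominus> x \<in> J"
      unfolding J_def mem_Collect_eq by (meson a_inv_closed basic_open_minus_subset order_trans)
  next
    fix x r assume x: "x \<in> J" "r \<in> carrier R"
    then have "basic_open R (r \<otimes> x) \<subseteq> basic_open R x"
      by (auto simp: J_def basic_open_mult)
    then show "r \<otimes> x \<in> J"
      using x unfolding J_def mem_Collect_eq by (meson m_closed order_trans)
  qed
  have SJ: "S \<subseteq> J"
  proof
    fix b assume "b \<in> S"
    then show "b \<in> J" using S by (auto simp: J_def intro!: exI[of _ "{b}"])
  qed
  have "a \<in> J"
  proof (rule ccontr)
    assume na: "a \<notin> J"
    have aM: "a \<in> M" using a by (simp add: M_def)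
    \<comment> \<open>A common element \<open>x\<close> would have \<open>D(a)\<close> inside
      \<open>D(x)\<close>, so the finite subcover of \<open>D(x)\<close> would also serve for
      \<open>D(a)\<close>.\<close>
    have disj: "J \<inter> M = {}"
      using na a unfolding J_def M_def by (smt (verit) disjoint_iff mem_Collect_eq order_trans)
    obtain P where P: "rng_prime_ideal R P" "J \<subseteq> P" "P \<inter> M = {}"
    proof (rule ex_rng_prime_ideal_disjoint[OF J _ _ _ disj])
      show "M \<noteq> {}" using aM by blast
      show "M \<subseteq> carrier R" by (auto simp: M_def)
      show "\<And>x y. x \<in> M \<Longrightarrow> y \<in> M \<Longrightarrow> x \<otimes> y \<in> M"
        by (auto simp: M_def m_closed basic_open_mult)
    qed
    then have "P \<in> basic_open R a"
      using aM by (auto simp: basic_open_def)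
    then obtain b where "b \<in> S" "P \<in> basic_open R b"
      using cover by blast
    then show False
      using SJ P(2) by (auto simp: basic_open_def)
  qed
  then show ?thesis
    using that by (auto simp: J_def)
qed

lemma compactin_basic_open:
  assumes a: "a \<in> carrier R" shows "compactin (prime_spectrum R) (basic_open R a)"
  unfolding compactin_def
proof (intro conjI allI impI)
  show "basic_open R a \<subseteq> topspace (prime_spectrum R)"
    using openin_basic_open[OF a] openin_subset by blast
next
  fix \<U> assume "(\<forall>U\<in>\<U>. openin (prime_spectrum R) U) \<and> basic_open R a \<subseteq> \<Union>\<U>"
  then have U: "\<And>U. U \<in> \<U> \<Longrightarrow> openin (prime_spectrum R) U" "basic_open R a \<subseteq> \<Union>\<U>"
    by auto
  define S where "S = {b \<in> carrier R. \<exists>U\<in>\<U>. basic_open R b \<subseteq> U}"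
  have "basic_open R a \<subseteq> (\<Union>b\<in>S. basic_open R b)"
  proof
    fix P assume "P \<in> basic_open R a"
    then obtain W where "W \<in> \<U>" "P \<in> W" using U(2) by blast
    then obtain b where "b \<in> carrier R" "P \<in> basic_open R b" "basic_open R b \<subseteq> W"
      using U(1) prime_spectrum_openE by metis
    then show "P \<in> (\<Union>b\<in>S. basic_open R b)"
      using \<open>W \<in> \<U>\<close> by (auto simp: S_def)
  qed
  then obtain F where F: "finite F" "F \<subseteq> S" "basic_open R a \<subseteq> (\<Union>b\<in>F. basic_open R b)"
    by (rule basic_open_finite_subcover[OF a, rotated]) (auto simp: S_def)
  then have "\<forall>b\<in>F. \<exists>U\<in>\<U>. basic_open R b \<subseteq> U"
    by (auto simp: S_def)
  then obtain u where u: "\<And>b. b \<in> F \<Longrightarrow> u b \<in> \<U> \<and> basic_open R b \<subseteq> u b"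
    by metis
  show "\<exists>\<F>. finite \<F> \<and> \<F> \<subseteq> \<U> \<and> basic_open R a \<subseteq> \<Union>\<F>"
    using F(1,3) u by (intro exI[of _ "u ` F"]) fastforce
qed

lemma coherent_prime_spectrum: "coherent (prime_spectrum R)"
  unfolding coherent_def
proof (intro exI conjI ballI allI impI)
  let ?B = "{U. \<exists>a\<in>carrier R. U = basic_open R a}"
  show "openin (prime_spectrum R) = arbitrary union_of (\<lambda>U. U \<in> ?B)"
    by (simp add: openin_prime_spectrum)
  show "openin (prime_spectrum R) U" "compactin (prime_spectrum R) U" if "U \<in> ?B" for U
    using that openin_basic_open compactin_basic_open by auto
  fix \<F> assume "\<F> \<subseteq> ?B" "finite \<F> \<and> \<F> \<noteq> {}"
  then have "finite \<F>" "\<F> \<noteq> {}" "\<F> \<subseteq> ?B" by auto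
  then show "\<Inter>\<F> \<in> ?B"
  proof (induction rule: finite_ne_induct)
    case (insert U \<F>)
    then obtain a b where "a \<in> carrier R" "U = basic_open R a" "b \<in> carrier R" "\<Inter>\<F> = basic_open R b"
      by auto
    then show ?case
      by (auto intro!: bexI[of _ "a \<otimes> b"] simp: basic_open_mult m_closed)
  qed auto
qed

section \<open>Closures of points and sobriety of the prime spectrum\<close>

lemma in_closure_of_prime_spectrum:
  "rng_prime_ideal R P \<Longrightarrow> Q \<in> prime_spectrum R closure_of {P} \<longleftrightarrow> rng_prime_ideal R Q \<and> P \<subseteq> Q"
  (is "?p \<Longrightarrow> ?l \<longleftrightarrow> ?r")
proof -
  assume P: ?p
  have "P \<subseteq> Q" if "?l"
  proof
    fix a assume "a \<in> P"
    then have a: "a \<in> carrier R"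
      using P rng_idealD(1) by (auto simp: rng_prime_ideal_def)
    show "a \<in> Q"
    proof (rule ccontr)
      assume "a \<notin> Q"
      then have "Q \<in> basic_open R a"
        using that by (simp add: in_closure_of topspace_prime_spectrum basic_open_def)
      then have "P \<in> basic_open R a"
        using that openin_basic_open[OF a] by (auto simp: in_closure_of)
      then show False
        using \<open>a \<in> P\<close> by (simp add: basic_open_def)
    qed
  qed
  moreover have ?l if ?r
    unfolding in_closure_of topspace_prime_spectrum
  proof (intro conjI allI impI)
    fix T assume "Q \<in> T \<and> openin (prime_spectrum R) T"
    then obtain a where "Q \<in> basic_open R a" "basic_open R a \<subseteq> T"
      using prime_spectrum_openE by metis
    then show "\<exists>P'. P' \<in> {P} \<and> P' \<in> T"
      using P that by (auto simp: basic_open_def)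
  qed (use that in auto)
  ultimately show ?thesis
    by (auto simp: in_closure_of topspace_prime_spectrum)
qed

lemma sober_prime_spectrum: "sober (prime_spectrum R)"
  unfolding sober_def
proof (intro allI impI)
  fix F assume "irreducible_closed (prime_spectrum R) F"
  then have F: "closedin (prime_spectrum R) F" "F \<noteq> {}"
    and irr: "\<And>G H. closedin (prime_spectrum R) G \<Longrightarrow> closedin (prime_spectrum R) H \<Longrightarrow>
                F = G \<union> H \<Longrightarrow> F = G \<or> F = H"
    by (auto simp: irreducible_closed_def)
  have prime: "rng_prime_ideal R P" if "P \<in> F" for P
    using that F(1) closedin_subset by (fastforce simp: topspace_prime_spectrum)
  note ideal = rng_prime_idealD(1)[OF prime]
  \<comment> \<open>This translates between \<open>F\<close> and its intersection: primality of the
    intersection comes from irreducibility of \<open>F\<close>, and its membership in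
    \<open>F\<close> from closedness.\<close>
  have meet: "F \<inter> basic_open R a \<noteq> {} \<longleftrightarrow> a \<notin> \<Inter>F" for a
    using prime by (auto simp: basic_open_def)
  have "rng_prime_ideal R (\<Inter>F)"
    unfolding rng_prime_ideal_def
  proof (intro conjI ballI impI)
    show "rng_ideal R (\<Inter>F)"
    proof (rule rng_idealI)
      show "\<Inter>F \<subseteq> carrier R"
        using rng_idealD(1)[OF ideal] F(2) by blast
    qed (use rng_idealD(2-5)[OF ideal] in auto)
    obtain P where "P \<in> F" using F(2) by blast
    then show "\<Inter>F \<noteq> carrier R"
      using rng_prime_idealD(2)[OF prime] rng_idealD(1)[OF ideal] by blast
  next
    fix a b assume ab: "a \<in> carrier R" "b \<in> carrier R" "a \<otimes> b \<in> \<Inter>F"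
    \<comment> \<open>Since \<open>ab\<close> lies in every member of \<open>F\<close>, no member
      lies in both \<open>D(a)\<close> and \<open>D(b)\<close>; \<open>F\<close> is the union of two
      closed subsets.\<close>
    then have "F = (F - basic_open R a) \<union> (F - basic_open R b)"
      using meet[of "a \<otimes> b"] by (auto simp: basic_open_mult)
    then have "F = F - basic_open R a \<or> F = F - basic_open R b"
      by (rule irr[rotated 2]) (intro closedin_diff F(1) openin_basic_open ab(1,2))+
    then show "a \<in> \<Inter>F \<or> b \<in> \<Inter>F"
      using meet by blast
  qed
  note P0 = this
  \<comment> \<open>Otherwise some \<open>D(a)\<close> contains the intersection and misses
    \<open>F\<close>, so that \<open>a\<close> lies in every member of \<open>F\<close> and yet not
    in the intersection.\<close>
  have "\<Inter>F \<in> F"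
  proof (rule ccontr)
    assume "\<Inter>F \<notin> F"
    then have "\<Inter>F \<in> topspace (prime_spectrum R) - F"
      using P0 by (simp add: topspace_prime_spectrum)
    then obtain a where "\<Inter>F \<in> basic_open R a" "basic_open R a \<subseteq> topspace (prime_spectrum R) - F"
      using F(1) prime_spectrum_openE by (metis closedin_def)
    then show False
      using meet[of a] by (auto simp: basic_open_def)
  qed
  then have eq: "F = prime_spectrum R closure_of {\<Inter>F}"
    using prime closure_of_minimal[OF _ F(1), of "{\<Inter>F}"]
    by (auto simp: in_closure_of_prime_spectrum[OF P0])
  show "\<exists>!P. P \<in> topspace (prime_spectrum R) \<and> F = prime_spectrum R closure_of {P}"
  proof (rule ex1I)
    show "\<Inter>F \<in> topspace (prime_spectrum R) \<and> F = prime_spectrum R closure_of {\<Inter>F}"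
      using P0 eq by (simp add: topspace_prime_spectrum)
  next
    fix P assume "P \<in> topspace (prime_spectrum R) \<and> F = prime_spectrum R closure_of {P}"
    then show "P = \<Inter>F"
      using P0 \<open>\<Inter>F \<in> F\<close> in_closure_of_prime_spectrum[of P]
      by (auto simp: topspace_prime_spectrum)
  qed
qed

lemma up_spectral_prime_spectrum: "up_spectral (prime_spectrum R)"
  by (simp add: up_spectral_def coherent_prime_spectrum sober_prime_spectrum)

end

section \<open>Invariance of up-spectrality under homeomorphism\<close>

lemma coherent_homeomorphic_image:
  assumes h: "homeomorphic_map X Y h" and X: "coherent X"
  shows "coherent Y"
proof -
  obtain \<B> where \<B>: "openin X = arbitrary union_of (\<lambda>U. U \<in> \<B>)"
    "\<And>U. U \<in> \<B> \<Longrightarrow> openin X U \<and> compactin X U"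
    "\<And>\<F>. \<F> \<subseteq> \<B> \<Longrightarrow> finite \<F> \<Longrightarrow> \<F> \<noteq> {} \<Longrightarrow> \<Inter>\<F> \<in> \<B>"
    using X unfolding coherent_def by (elim exE conjE) (simp add: Ball_def)
  have sub: "U \<subseteq> topspace X" if "U \<in> \<B>" for U
    using \<B>(2)[OF that] openin_subset by auto
  have op: "openin Y V \<longleftrightarrow> (\<exists>\<U>\<subseteq>\<B>. V = h ` \<Union>\<U>)" for V
  proof
    assume V: "openin Y V"
    then have "V \<subseteq> h ` topspace X"
      using homeomorphic_imp_surjective_map[OF h] openin_subset by simp
    then obtain U where U: "U \<subseteq> topspace X" "V = h ` U"
      by (meson subset_imageE)
    then have "openin X U"
      using V homeomorphic_map_openness[OF h U(1)] by simp
    with U show "\<exists>\<U>\<subseteq>\<B>. V = h ` \<Union>\<U>"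
      unfolding \<B>(1) union_of_def arbitrary_def by auto
  next
    assume "\<exists>\<U>\<subseteq>\<B>. V = h ` \<Union>\<U>"
    then obtain \<U> where U: "\<U> \<subseteq> \<B>" "V = h ` \<Union>\<U>" by blast
    then have "openin X (\<Union>\<U>)" using \<B>(2) by (meson openin_Union subsetD)
    then show "openin Y V"
      using U(2) homeomorphic_map_openness[OF h openin_subset] by simp
  qed
  show ?thesis
    unfolding coherent_def
  proof (intro exI conjI ballI allI impI)
    show "openin Y = arbitrary union_of (\<lambda>U. U \<in> image h ` \<B>)"
    proof
      fix V
      show "openin Y V = (arbitrary union_of (\<lambda>U. U \<in> image h ` \<B>)) V"
      proof
        assume "openin Y V"
        then obtain \<U> where "\<U> \<subseteq> \<B>" "V = h ` \<Union>\<U>"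
          unfolding op by blast
        then show "(arbitrary union_of (\<lambda>U. U \<in> image h ` \<B>)) V"
          unfolding union_of_def arbitrary_def by (intro exI[of _ "image h ` \<U>"]) auto
      next
        assume "(arbitrary union_of (\<lambda>U. U \<in> image h ` \<B>)) V"
        then obtain \<W> where "\<W> \<subseteq> image h ` \<B>" "\<Union>\<W> = V"
          unfolding union_of_def by auto
        then obtain \<U> where "\<U> \<subseteq> \<B>" "\<W> = image h ` \<U>"
          by (meson subset_imageE)
        then show "openin Y V"
          using \<open>\<Union>\<W> = V\<close> by (auto simp: op intro!: exI[of _ \<U>])
      qed
    qed
  next
    fix V assume "V \<in> image h ` \<B>"
    then obtain U where "U \<in> \<B>" "V = h ` U" by blast
    then show "openin Y V" "compactin Y V"
      using \<B>(2) sub homeomorphic_map_openness[OF h] homeomorphic_map_compactness[OF h] by auto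
  next
    fix \<F> assume "\<F> \<subseteq> image h ` \<B>" "finite \<F> \<and> \<F> \<noteq> {}"
    then obtain \<G> where G: "\<G> \<subseteq> \<B>" "finite \<G>" "\<G> \<noteq> {}" "\<F> = image h ` \<G>"
      by (metis finite_subset_image image_is_empty)
    \<comment> \<open>Injectivity on the space makes \<open>h\<close> commute with the intersection
      of a non-empty family; \<open>id\<close> puts the family into indexed form.\<close>
    have "inj_on h (topspace X)"
      using h by (rule homeomorphic_imp_injective_map)
    obtain U where "U \<in> \<G>" using G(3) by blast
    have "h ` \<Inter>(id ` \<G>) = (\<Inter>U\<in>\<G>. h ` id U)"
      by (rule image_INT[OF \<open>inj_on h (topspace X)\<close> _ \<open>U \<in> \<G>\<close>]) (use G(1) sub in auto)
    then have "\<Inter>\<F> = h ` \<Inter>\<G>"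
      using G(4) by simp
    then show "\<Inter>\<F> \<in> image h ` \<B>"
      using \<B>(3) G by blast
  qed
qed

lemma sober_homeomorphic_image:
  assumes h: "homeomorphic_map X Y h" and X: "sober X"
  shows "sober Y"
  unfolding sober_def
proof (intro allI impI)
  fix F assume F: "irreducible_closed Y F"
  note surj = homeomorphic_imp_surjective_map[OF h] and inj = homeomorphic_imp_injective_map[OF h]
  have cl: "closedin Y (h ` G) \<longleftrightarrow> closedin X G" if "G \<subseteq> topspace X" for G
    using homeomorphic_map_closedness[OF h that] .
  have "F \<subseteq> h ` topspace X"
    using F closedin_subset unfolding irreducible_closed_def surj by blast
  then obtain E where E: "E \<subseteq> topspace X" "F = h ` E"
    by (meson subset_imageE)
  have hinj: "G = H" if "h ` G = h ` H" "G \<subseteq> topspace X" "H \<subseteq> topspace X" for G H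
    using that inj inj_on_image_eq_iff by blast
  have "irreducible_closed X E"
    unfolding irreducible_closed_def
  proof (intro conjI allI impI)
    show "closedin X E" "E \<noteq> {}"
      using F cl[OF E(1)] E(2) by (auto simp: irreducible_closed_def)
  next
    fix G H assume GH: "closedin X G \<and> closedin X H \<and> E = G \<union> H"
    then have "F = h ` G \<union> h ` H" "closedin Y (h ` G)" "closedin Y (h ` H)"
      using E cl closedin_subset by blast+
    then have "F = h ` G \<or> F = h ` H"
      using F unfolding irreducible_closed_def by blast
    then show "E = G \<or> E = H"
      using GH E hinj closedin_subset by metis
  qed
  then obtain x where x: "x \<in> topspace X" "E = X closure_of {x}"
    and uniq: "\<And>y. y \<in> topspace X \<Longrightarrow> E = X closure_of {y} \<Longrightarrow> y = x"
    using X unfolding sober_def by blast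
  have clo: "Y closure_of {h y} = h ` (X closure_of {y})" if "y \<in> topspace X" for y
    using homeomorphic_map_closure_of[OF h, of "{y}"] that by simp
  show "\<exists>!y. y \<in> topspace Y \<and> F = Y closure_of {y}"
  proof (rule ex1I)
    show "h x \<in> topspace Y \<and> F = Y closure_of {h x}"
      using x E clo surj by auto
  next
    fix y assume y: "y \<in> topspace Y \<and> F = Y closure_of {y}"
    then obtain z where z: "z \<in> topspace X" "y = h z"
      using surj by blast
    then have "E = X closure_of {z}"
      using y E clo[of z] hinj closure_of_subset_topspace by metis
    then show "y = h x"
      using uniq z by blast
  qed
qed

lemma almost_spectral_imp_up_spectral:
  assumes "almost_spectral TYPE('r) Z" shows "up_spectral Z"
proof -
  obtain R :: "'r ring" where R: "comm_rng R" "Z homeomorphic_space prime_spectrum R"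
    using assms by (auto simp: almost_spectral_def)
  then obtain h where "homeomorphic_map (prime_spectrum R) Z h"
    using homeomorphic_space homeomorphic_space_sym by blast
  then show ?thesis
    using comm_rng.up_spectral_prime_spectrum[OF R(1)]
      coherent_homeomorphic_image sober_homeomorphic_image by (auto simp: up_spectral_def)
qed

section \<open>Constructible functions on coherent spaces\<close>

lemma coherent_basisE:
  assumes "coherent Z" "openin Z W" "x \<in> W"
  obtains U where "openin Z U" "compactin Z U" "x \<in> U" "U \<subseteq> W"
proof -
  obtain \<B> where \<B>: "openin Z = arbitrary union_of (\<lambda>U. U \<in> \<B>)" "\<forall>U\<in>\<B>. openin Z U \<and> compactin Z U"
    using assms(1) unfolding coherent_def by blast
  obtain \<U> where "\<U> \<subseteq> \<B>" "\<Union>\<U> = W"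
    using assms(2) unfolding \<B>(1) union_of_def by auto
  then show ?thesis
    using that \<B>(2) assms(3) by blast
qed

text \<open>Coherence speaks of one particular basis only. By compactness every compact open set is
  a finite union of its members, and the intersection distributes over the two unions.\<close>

lemma coherent_compactin_Int:
  assumes Z: "coherent Z" and U: "openin Z U" "compactin Z U" and V: "openin Z V" "compactin Z V"
  shows "compactin Z (U \<inter> V)"
proof -
  obtain \<B> where \<B>: "openin Z = arbitrary union_of (\<lambda>U. U \<in> \<B>)" "\<forall>U\<in>\<B>. openin Z U \<and> compactin Z U"
    "\<forall>\<F>\<subseteq>\<B>. finite \<F> \<and> \<F> \<noteq> {} \<longrightarrow> \<Inter>\<F> \<in> \<B>"
    using Z unfolding coherent_def by blast
  have fin: "\<exists>\<F>. finite \<F> \<and> \<F> \<subseteq> \<B> \<and> W = \<Union>\<F>" if W: "openin Z W" "compactin Z W" for W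
  proof -
    obtain \<W> where \<W>: "\<W> \<subseteq> \<B>" "\<Union>\<W> = W"
      using W(1) unfolding \<B>(1) union_of_def by auto
    then obtain \<F> where "finite \<F>" "\<F> \<subseteq> \<W>" "W \<subseteq> \<Union>\<F>"
      using W(2) \<B>(2) unfolding compactin_def by (metis order_refl subsetD)
    then show ?thesis
      using \<W> by (intro exI[of _ \<F>]) auto
  qed
  obtain \<F> \<G> where F: "finite \<F>" "\<F> \<subseteq> \<B>" "U = \<Union>\<F>" and G: "finite \<G>" "\<G> \<subseteq> \<B>" "V = \<Union>\<G>"
    using fin[OF U] fin[OF V] by blast
  have "S \<inter> T \<in> \<B>" if "S \<in> \<F>" "T \<in> \<G>" for S T
    using \<B>(3)[rule_format, of "{S, T}"] that F(2) G(2) by auto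
  then have "compactin Z (S \<inter> T)" if "S \<in> \<F>" "T \<in> \<G>" for S T
    using \<B>(2) that by blast
  moreover have "U \<inter> V = (\<Union>(S, T)\<in>\<F> \<times> \<G>. S \<inter> T)"
    using F(3) G(3) by auto
  ultimately show ?thesis
    using F(1) G(1) by (auto intro!: compactin_Union)
qed

lemma coherent_compactin_Inter:
  assumes Z: "coherent Z" and "finite \<F>" "\<F> \<noteq> {}" "\<And>U. U \<in> \<F> \<Longrightarrow> openin Z U \<and> compactin Z U"
  shows "compactin Z (\<Inter>\<F>)"
proof -
  have "openin Z (\<Inter>\<F>) \<and> compactin Z (\<Inter>\<F>)"
    using assms(2-4)
  proof (induction rule: finite_ne_induct)
    case (insert U \<F>)
    then show ?case
      using coherent_compactin_Int[OF Z, of U "\<Inter>\<F>"] by auto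
  qed auto
  then show ?thesis ..
qed

lemma irreducible_closed_closure_of_point:
  assumes "x \<in> topspace Z" shows "irreducible_closed Z (Z closure_of {x})"
  unfolding irreducible_closed_def
proof (intro conjI allI impI)
  have x: "x \<in> Z closure_of {x}"
    using assms by (simp add: in_closure_of)
  then show "Z closure_of {x} \<noteq> {}" by blast
  fix G H assume GH: "closedin Z G \<and> closedin Z H \<and> Z closure_of {x} = G \<union> H"
  then have "x \<in> G \<or> x \<in> H" using x by blast
  then have "Z closure_of {x} \<subseteq> G \<or> Z closure_of {x} \<subseteq> H"
    using GH closure_of_minimal[of "{x}"] by (metis empty_subsetI insert_subset)
  then show "Z closure_of {x} = G \<or> Z closure_of {x} = H"
    using GH by blast
qed simp

text \<open>Points with the same open neighbourhoods have the same closure, and an irreducible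
  closed set has only one generic point.\<close>

lemma sober_imp_T0:
  assumes Z: "sober Z" and x: "x \<in> topspace Z" and y: "y \<in> topspace Z"
    and eq: "\<And>U. openin Z U \<Longrightarrow> x \<in> U \<longleftrightarrow> y \<in> U"
  shows "x = y"
proof -
  have "Z closure_of {x} = Z closure_of {y}"
    using eq by (auto simp: in_closure_of)
  then show ?thesis
    using Z irreducible_closed_closure_of_point[OF x] x y unfolding sober_def by metis
qed

text \<open>The value depends only on which of finitely many compact open sets contain the argument.
  The last clause bounds the support and also forces the value 0 outside \<open>topspace Z\<close>,
  so that a function on the space has a unique representative.\<close>

definition constructible :: "'a topology \<Rightarrow> ('a \<Rightarrow> 'b::zero) \<Rightarrow> bool" where
  "constructible Z f \<longleftrightarrow> (\<exists>\<U>. finite \<U> \<and> (\<forall>U\<in>\<U>. openin Z U \<and> compactin Z U) \<and>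
     (\<forall>x y. (\<forall>U\<in>\<U>. x \<in> U \<longleftrightarrow> y \<in> U) \<longrightarrow> f x = f y) \<and> (\<forall>x. x \<notin> \<Union>\<U> \<longrightarrow> f x = 0))"

lemma constructibleE:
  assumes "constructible Z f"
  obtains \<U> where "finite \<U>" "\<forall>U\<in>\<U>. openin Z U \<and> compactin Z U"
    "\<forall>x y. (\<forall>U\<in>\<U>. x \<in> U \<longleftrightarrow> y \<in> U) \<longrightarrow> f x = f y" "\<forall>x. x \<notin> \<Union>\<U> \<longrightarrow> f x = 0"
  using assms unfolding constructible_def by (elim exE conjE) (rule that)

section \<open>Operations on constructible functions, finiteness of their range, compactness of
  their supports\<close>

lemma constructible_binop:
  assumes f: "constructible Z f" and g: "constructible Z g" and h: "h 0 0 = 0"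
  shows "constructible Z (\<lambda>x. h (f x) (g x))"
proof -
  obtain \<U> where U: "finite \<U>" "\<forall>U\<in>\<U>. openin Z U \<and> compactin Z U"
    "\<forall>x y. (\<forall>U\<in>\<U>. x \<in> U \<longleftrightarrow> y \<in> U) \<longrightarrow> f x = f y" "\<forall>x. x \<notin> \<Union>\<U> \<longrightarrow> f x = 0"
    by (rule constructibleE[OF f])
  obtain \<V> where V: "finite \<V>" "\<forall>U\<in>\<V>. openin Z U \<and> compactin Z U"
    "\<forall>x y. (\<forall>U\<in>\<V>. x \<in> U \<longleftrightarrow> y \<in> U) \<longrightarrow> g x = g y" "\<forall>x. x \<notin> \<Union>\<V> \<longrightarrow> g x = 0"
    by (rule constructibleE[OF g])
  show ?thesis
    unfolding constructible_def
  proof (intro exI conjI allI impI)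
    show "finite (\<U> \<union> \<V>)" using U(1) V(1) by simp
    show "\<forall>U\<in>\<U> \<union> \<V>. openin Z U \<and> compactin Z U" using U(2) V(2) by auto
  next
    fix x y assume "\<forall>U\<in>\<U> \<union> \<V>. x \<in> U \<longleftrightarrow> y \<in> U"
    then have "f x = f y" "g x = g y"
      using U(3)[rule_format, of x y] V(3)[rule_format, of x y] by simp_all
    then show "h (f x) (g x) = h (f y) (g y)" by simp
  next
    fix x assume "x \<notin> \<Union>(\<U> \<union> \<V>)"
    then show "h (f x) (g x) = 0" using U(4) V(4) h by simp
  qed
qed

lemma constructible_indicator:
  assumes "openin Z U" "compactin Z U"
  shows "constructible Z (\<lambda>x. if x \<in> U then c else 0)"
  unfolding constructible_def by (rule exI[of _ "{U}"]) (use assms in auto)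

lemma constructible_finite_range:
  assumes "constructible Z f" shows "finite (range f)"
proof -
  obtain \<U> where U: "finite \<U>" "\<forall>x y. (\<forall>U\<in>\<U>. x \<in> U \<longleftrightarrow> y \<in> U) \<longrightarrow> f x = f y"
    using constructibleE[OF assms] by metis
  \<comment> \<open>The function factors through \<open>\<tau>\<close>, which takes values in the
    finite set \<open>Pow \<U>\<close>.\<close>
  define \<tau> where "\<tau> x = {U\<in>\<U>. x \<in> U}" for x
  have "f x = f (inv_into UNIV \<tau> (\<tau> x))" for x
  proof -
    have "\<tau> x = \<tau> (inv_into UNIV \<tau> (\<tau> x))"
      by (simp add: f_inv_into_f)
    then show ?thesis
      using U(2)[rule_format, of x "inv_into UNIV \<tau> (\<tau> x)"] unfolding \<tau>_def by blast
  qed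
  then have "range f \<subseteq> (f \<circ> inv_into UNIV \<tau>) ` Pow \<U>"
    unfolding \<tau>_def by fastforce
  then show ?thesis
    using U(1) by (meson finite_Pow_iff finite_imageI finite_subset)
qed

lemma constructible_support_cover:
  assumes "constructible Z f"
  obtains W where "openin Z W" "compactin Z W" "{x. f x \<noteq> 0} \<subseteq> W"
proof -
  obtain \<U> where U: "finite \<U>" "\<forall>U\<in>\<U>. openin Z U \<and> compactin Z U" "\<forall>x. x \<notin> \<Union>\<U> \<longrightarrow> f x = 0"
    using constructibleE[OF assms] by metis
  show ?thesis
  proof
    show "openin Z (\<Union>\<U>)" "compactin Z (\<Union>\<U>)"
      using U(1,2) by (auto intro: compactin_Union)
    show "{x. f x \<noteq> 0} \<subseteq> \<Union>\<U>"
      using U(3) by blast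
  qed
qed

text \<open>The support is a finite union of fibres of \<open>\<tau>\<close>. The fibre over
  \<open>S\<close> is a closed part of the intersection of \<open>S\<close>, which is compact by
  coherence; \<open>S\<close> is non-empty because the function vanishes off the union of
  \<open>\<U>\<close>.\<close>

lemma constructible_support_compact:
  assumes Z: "coherent Z" and f: "constructible Z f"
  shows "compactin Z {x. f x \<noteq> 0}"
proof -
  obtain \<U> where U: "finite \<U>" "\<forall>U\<in>\<U>. openin Z U \<and> compactin Z U"
    "\<forall>x y. (\<forall>U\<in>\<U>. x \<in> U \<longleftrightarrow> y \<in> U) \<longrightarrow> f x = f y" "\<forall>x. x \<notin> \<Union>\<U> \<longrightarrow> f x = 0"
    by (rule constructibleE[OF f])
  define \<tau> where "\<tau> x = {U\<in>\<U>. x \<in> U}" for x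
  define \<S> where "\<S> = \<tau> ` {x. f x \<noteq> 0}"
  have ne: "S \<noteq> {}" "S \<subseteq> \<U>" if "S \<in> \<S>" for S
    using that U(4) unfolding \<S>_def \<tau>_def by fast+
  have val: "f x = f y" if "\<tau> x = \<tau> y" for x y
    using that unfolding \<tau>_def by (intro U(3)[rule_format]) blast
  have comp: "compactin Z {x. \<tau> x = S}" if S: "S \<in> \<S>" for S
  proof -
    have "compactin Z (\<Inter>S)"
      by (rule coherent_compactin_Inter[OF Z])
        (use ne[OF S] U(1,2) in \<open>auto intro: finite_subset\<close>)
    moreover have "closedin Z (topspace Z - \<Union>(\<U> - S))"
      using U(2) by (intro closedin_diff closedin_topspace openin_Union) auto
    ultimately have "compactin Z (\<Inter>S \<inter> (topspace Z - \<Union>(\<U> - S)))"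
      by (rule compact_Int_closedin)
    moreover have "\<Inter>S \<subseteq> topspace Z"
      using \<open>compactin Z (\<Inter>S)\<close> compactin_subset_topspace by blast
    then have "{x. \<tau> x = S} = \<Inter>S \<inter> (topspace Z - \<Union>(\<U> - S))"
      using ne(2)[OF S] unfolding \<tau>_def by auto
    ultimately show ?thesis by simp
  qed
  have "{x. f x \<noteq> 0} = (\<Union>S\<in>\<S>. {x. \<tau> x = S})"
  proof
    show "{x. f x \<noteq> 0} \<subseteq> (\<Union>S\<in>\<S>. {x. \<tau> x = S})"
      by (auto simp: \<S>_def)
    show "(\<Union>S\<in>\<S>. {x. \<tau> x = S}) \<subseteq> {x. f x \<noteq> 0}"
    proof clarify
      fix y assume "\<tau> y \<in> \<S>" "f y = 0"
      then obtain x where "f x \<noteq> 0" "\<tau> y = \<tau> x"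
        unfolding \<S>_def by blast
      then show False
        using val[of y x] \<open>f y = 0\<close> by simp
    qed
  qed
  moreover have "\<S> \<subseteq> Pow \<U>"
    by (auto simp: \<S>_def \<tau>_def)
  then have "finite \<S>"
    using U(1) by (meson finite_Pow_iff finite_subset)
  ultimately show ?thesis
    using comp by (auto intro: compactin_Union)
qed

section \<open>The ring of sections\<close>

text \<open>The axioms on \<open>t\<close> make \<open>t U\<close>, cut off outside
  \<open>U\<close>, a section. The bound in \<open>v_bounded\<close> is uniform in \<open>p\<close>,
  so that one exponent clears a denominator at all points. With \<open>squares\<close>, two
  functions can be merged into one that vanishes only at their common zeros.\<close>

locale valued_field =
  fixes v :: "'a \<Rightarrow> 'k::field \<Rightarrow> int" and K :: "'a \<Rightarrow> 'k set" and t :: "'a set \<Rightarrow> 'k"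
  assumes v_mult: "x \<noteq> 0 \<Longrightarrow> y \<noteq> 0 \<Longrightarrow> v p (x * y) = v p x + v p y"
    and v_add: "x \<noteq> 0 \<Longrightarrow> y \<noteq> 0 \<Longrightarrow> x + y \<noteq> 0 \<Longrightarrow> min (v p x) (v p y) \<le> v p (x + y)"
    and K_zero: "0 \<in> K p"
    and K_add: "x \<in> K p \<Longrightarrow> y \<in> K p \<Longrightarrow> x + y \<in> K p"
    and K_mult: "x \<in> K p \<Longrightarrow> y \<in> K p \<Longrightarrow> x * y \<in> K p"
    and K_uminus: "x \<in> K p \<Longrightarrow> - x \<in> K p"
    and K_inverse: "x \<in> K p \<Longrightarrow> inverse x \<in> K p"
    and v_K: "x \<in> K p \<Longrightarrow> x \<noteq> 0 \<Longrightarrow> v p x = 0"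
    and t_nonzero: "t U \<noteq> 0"
    and t_K: "p \<in> U \<Longrightarrow> t U \<in> K p"
    and t_pos: "p \<notin> U \<Longrightarrow> 0 < v p (t U)"
    and v_bounded: "x \<noteq> 0 \<Longrightarrow> \<exists>B. \<forall>p. v p x \<le> B"
    and squares: "x * x + t U * (y * y) = 0 \<Longrightarrow> x = 0 \<and> y = 0"
begin

section \<open>Calculus of the valuations\<close>

text \<open>The valuation of \<open>0\<close> is meant to be infinite, but \<^term>\<open>v p 0\<close> is unspecified.\<close>

definition vge :: "'a \<Rightarrow> int \<Rightarrow> 'k \<Rightarrow> bool" where
  "vge p n x \<longleftrightarrow> x = 0 \<or> n \<le> v p x"

lemma v_one: "v p 1 = 0"
  using v_mult[of 1 1 p] by simp

lemma v_uminus: "v p (- x) = v p x"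
proof (cases "x = 0")
  case False
  then have "2 * v p (- x) = 2 * v p x"
    using v_mult[of "- x" "- x" p] v_mult[of x x p] by simp
  then show ?thesis by simp
qed simp

lemma v_inverse: "x \<noteq> 0 \<Longrightarrow> v p (inverse x) = - v p x"
  using v_mult[of x "inverse x" p] v_one[of p] by simp

lemma v_power: "x \<noteq> 0 \<Longrightarrow> v p (x ^ n) = int n * v p x"
  by (induction n) (simp_all add: v_one v_mult algebra_simps)

lemma vge_zero [simp]: "vge p n 0"
  by (simp add: vge_def)

lemma vge_add:
  assumes "vge p n x" "vge p n y" shows "vge p n (x + y)"
proof (cases "x = 0 \<or> y = 0 \<or> x + y = 0")
  case False
  then show ?thesis
    using assms v_add[of x y p] by (auto simp: vge_def min_def split: if_splits)
qed (use assms in \<open>auto simp: vge_def\<close>)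

lemma vge_uminus: "vge p n (- x) \<longleftrightarrow> vge p n x"
  by (simp add: vge_def v_uminus)

lemma vge_diff: "vge p n x \<Longrightarrow> vge p n y \<Longrightarrow> vge p n (x - y)"
  using vge_add[of p n x "- y"] by (simp add: vge_uminus)

lemma vge_mult:
  assumes "vge p m x" "vge p n y" shows "vge p (m + n) (x * y)"
proof (cases "x = 0 \<or> y = 0")
  case False
  then show ?thesis
    using assms by (simp add: vge_def v_mult)
qed (auto simp: vge_def)

lemma vge_mono: "vge p n x \<Longrightarrow> m \<le> n \<Longrightarrow> vge p m x"
  by (auto simp: vge_def)

lemma vge_K: "x \<in> K p \<Longrightarrow> vge p 0 x"
  by (cases "x = 0") (auto simp: vge_def v_K)

lemma K_power: "x \<in> K p \<Longrightarrow> x \<noteq> 0 \<Longrightarrow> x ^ n \<in> K p"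
proof (induction n)
  case 0
  then show ?case using K_mult[OF _ K_inverse, of x p x] by simp
qed (simp add: K_mult)

lemma not_vge_K: "x \<in> K p \<Longrightarrow> vge p 1 x \<Longrightarrow> x = 0"
  by (cases "x = 0") (auto simp: vge_def v_K)

lemma vge_near:
  assumes "y \<in> K p" "vge p 1 (x - y)" shows "vge p 0 x"
  using vge_add[OF vge_mono[OF assms(2), of 0] vge_K[OF assms(1)]] by simp

text \<open>If \<open>x\<close> were 0 or had positive valuation, so would
  \<open>y = x - (x - y)\<close>, although nonzero elements of \<open>K p\<close> have valuation 0.
  In other words \<open>K p\<close> embeds into the residue field.\<close>

lemma near_nonzero:
  assumes "y \<in> K p" "vge p 1 (x - y)" "y \<noteq> 0" shows "x \<noteq> 0" "v p x = 0"
proof -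
  show x: "x \<noteq> 0"
    using not_vge_K[of y p] assms by (auto simp: vge_uminus)
  have "\<not> vge p 1 x"
  proof
    assume "vge p 1 x"
    then have "vge p 1 y"
      using vge_diff[OF _ assms(2), of x] by simp
    then show False
      using not_vge_K assms by blast
  qed
  then show "v p x = 0"
    using vge_near[OF assms(1,2)] by (auto simp: vge_def)
qed

text \<open>The valuation is the one attached to the point \<open>p\<close> itself: near
  \<open>p\<close> all values have the residue of \<open>f p\<close>. The threshold 1 expresses
  positivity of an integer.\<close>

definition continuous_at :: "'a topology \<Rightarrow> ('a \<Rightarrow> 'k) \<Rightarrow> 'a \<Rightarrow> bool" where
  "continuous_at Z f p \<longleftrightarrow> (\<exists>N. openin Z N \<and> p \<in> N \<and> (\<forall>x\<in>N. vge p 1 (f x - f p)))"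

definition sections :: "'a topology \<Rightarrow> ('a \<Rightarrow> 'k) set" where
  "sections Z = {f. constructible Z f \<and> (\<forall>p\<in>topspace Z. f p \<in> K p \<and> continuous_at Z f p)}"

section \<open>Pointwise operations on sections\<close>

lemma continuous_atI:
  "openin Z N \<Longrightarrow> p \<in> N \<Longrightarrow> (\<And>x. x \<in> N \<Longrightarrow> vge p 1 (f x - f p)) \<Longrightarrow> continuous_at Z f p"
  unfolding continuous_at_def by blast

lemma continuous_at2E:
  assumes "continuous_at Z f p" "continuous_at Z g p"
  obtains N where "openin Z N" "p \<in> N" "\<And>x. x \<in> N \<Longrightarrow> vge p 1 (f x - f p)"
    "\<And>x. x \<in> N \<Longrightarrow> vge p 1 (g x - g p)"
proof -
  obtain M N where "openin Z M" "p \<in> M" "\<forall>x\<in>M. vge p 1 (f x - f p)"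
    "openin Z N" "p \<in> N" "\<forall>x\<in>N. vge p 1 (g x - g p)"
    using assms unfolding continuous_at_def by blast
  then show ?thesis
    using that[of "M \<inter> N"] by auto
qed

lemma sectionsD:
  assumes "f \<in> sections Z"
  shows "constructible Z f" "p \<in> topspace Z \<Longrightarrow> f p \<in> K p" "p \<in> topspace Z \<Longrightarrow> continuous_at Z f p"
  using assms by (auto simp: sections_def)

lemma sections_zero: "(\<lambda>x. 0) \<in> sections Z"
  unfolding sections_def
  by (auto simp: constructible_def K_zero intro: exI[of _ "{}"] continuous_atI[of Z "topspace Z"])

lemma sections_add:
  assumes f: "f \<in> sections Z" and g: "g \<in> sections Z"
  shows "(\<lambda>x. f x + g x) \<in> sections Z"
  unfolding sections_def
proof (intro CollectI conjI ballI)
  show "constructible Z (\<lambda>x. f x + g x)"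
    by (rule constructible_binop) (use sectionsD(1) f g in auto)
  fix p assume p: "p \<in> topspace Z"
  show "f p + g p \<in> K p"
    using sectionsD(2) f g p K_add by blast
  obtain N where N: "openin Z N" "p \<in> N" "\<And>x. x \<in> N \<Longrightarrow> vge p 1 (f x - f p)"
    "\<And>x. x \<in> N \<Longrightarrow> vge p 1 (g x - g p)"
    using continuous_at2E[OF sectionsD(3)[OF f p] sectionsD(3)[OF g p]] by metis
  show "continuous_at Z (\<lambda>x. f x + g x) p"
  proof (rule continuous_atI[OF N(1,2)])
    fix x assume "x \<in> N"
    then show "vge p 1 (f x + g x - (f p + g p))"
      using vge_add[OF N(3,4), of x x] by (simp add: algebra_simps)
  qed
qed

lemma sections_mult:
  assumes f: "f \<in> sections Z" and g: "g \<in> sections Z"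
  shows "(\<lambda>x. f x * g x) \<in> sections Z"
  unfolding sections_def
proof (intro CollectI conjI ballI)
  show "constructible Z (\<lambda>x. f x * g x)"
    by (rule constructible_binop) (use sectionsD(1) f g in auto)
  fix p assume p: "p \<in> topspace Z"
  note K = sectionsD(2)[OF f p] sectionsD(2)[OF g p]
  show "f p * g p \<in> K p"
    using K K_mult by blast
  obtain N where N: "openin Z N" "p \<in> N" "\<And>x. x \<in> N \<Longrightarrow> vge p 1 (f x - f p)"
    "\<And>x. x \<in> N \<Longrightarrow> vge p 1 (g x - g p)"
    using continuous_at2E[OF sectionsD(3)[OF f p] sectionsD(3)[OF g p]] by metis
  show "continuous_at Z (\<lambda>x. f x * g x) p"
  proof (rule continuous_atI[OF N(1,2)])
    fix x assume x: "x \<in> N"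
    have "vge p (0 + 1) (f x * (g x - g p))" "vge p (0 + 1) (g p * (f x - f p))"
      using vge_mult[OF vge_near[OF K(1) N(3)[OF x]] N(4)[OF x]] vge_mult[OF vge_K[OF K(2)] N(3)[OF x]]
      by simp_all
    from vge_add[OF this] show "vge p 1 (f x * g x - f p * g p)"
      by (simp add: algebra_simps)
  qed
qed

lemma sections_uminus:
  assumes f: "f \<in> sections Z" shows "(\<lambda>x. - f x) \<in> sections Z"
  unfolding sections_def
proof (intro CollectI conjI ballI)
  show "constructible Z (\<lambda>x. - f x)"
    using constructible_binop[OF sectionsD(1)[OF f] sectionsD(1)[OF f], of "\<lambda>a b. - a"] by simp
  fix p assume p: "p \<in> topspace Z"
  show "- f p \<in> K p"
    using sectionsD(2)[OF f p] K_uminus by blast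
  obtain N where N: "openin Z N" "p \<in> N" "\<forall>x\<in>N. vge p 1 (f x - f p)"
    using sectionsD(3)[OF f p] unfolding continuous_at_def by blast
  show "continuous_at Z (\<lambda>x. - f x) p"
  proof (rule continuous_atI[OF N(1,2)])
    fix x assume "x \<in> N"
    then have "vge p 1 (- (f x - f p))"
      using N(3) by (simp add: vge_uminus del: minus_diff_eq)
    then show "vge p 1 (- f x - - f p)" by simp
  qed
qed

section \<open>Sections and their supports\<close>

definition bump :: "'a set \<Rightarrow> 'a \<Rightarrow> 'k" where
  "bump U = (\<lambda>x. if x \<in> U then t U else 0)"

lemma bump_nonzero_iff: "bump U x \<noteq> 0 \<longleftrightarrow> x \<in> U"
  by (simp add: bump_def t_nonzero)

text \<open>At points of \<open>U\<close> the function is locally constant. At a point outside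
  \<open>U\<close> the only possible jump is \<open>t U\<close>, which has positive valuation there,
  so the whole space serves as neighbourhood.\<close>

lemma sections_bump:
  assumes U: "openin Z U" "compactin Z U" shows "bump U \<in> sections Z"
  unfolding sections_def
proof (intro CollectI conjI ballI)
  show "constructible Z (bump U)"
    unfolding bump_def by (rule constructible_indicator[OF U])
  fix p assume p: "p \<in> topspace Z"
  show "bump U p \<in> K p"
    by (simp add: bump_def t_K K_zero)
  show "continuous_at Z (bump U) p"
  proof (cases "p \<in> U")
    case True
    then show ?thesis
      by (intro continuous_atI[OF U(1)]) (auto simp: bump_def)
  next
    case False
    then show ?thesis
      using t_pos[OF False] by (intro continuous_atI[OF openin_topspace p]) (auto simp: bump_def vge_def)
  qed
qed

lemma section_support_subset: "f \<in> sections Z \<Longrightarrow> {x. f x \<noteq> 0} \<subseteq> topspace Z"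
  using constructible_support_cover[OF sectionsD(1)] openin_subset by (metis subset_trans)

text \<open>Near a point \<open>p\<close> of the support the values are congruent to the nonzero
  element \<open>f p\<close> of \<open>K p\<close>, hence nonzero by
  \<open>near_nonzero\<close>.\<close>

lemma openin_section_support:
  assumes f: "f \<in> sections Z" shows "openin Z {x. f x \<noteq> 0}"
proof (subst openin_subopen, intro ballI)
  fix p assume "p \<in> {x. f x \<noteq> 0}"
  then have p: "p \<in> topspace Z" "f p \<noteq> 0"
    using section_support_subset[OF f] by auto
  obtain N where N: "openin Z N" "p \<in> N" "\<forall>x\<in>N. vge p 1 (f x - f p)"
    using sectionsD(3)[OF f p(1)] unfolding continuous_at_def by blast
  have "N \<subseteq> {x. f x \<noteq> 0}"
    using near_nonzero(1)[OF sectionsD(2)[OF f p(1)] _ p(2)] N(3) by blast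
  then show "\<exists>T. openin Z T \<and> p \<in> T \<and> T \<subseteq> {x. f x \<noteq> 0}"
    using N by blast
qed

text \<open>As \<open>b\<close> has finite range, its nonzero values have valuations bounded by one
  \<open>B\<close> at all points. Where \<open>b\<close> vanishes, a power of \<open>a\<close>
  beyond \<open>B\<close> outweighs the denominator; elsewhere \<open>b\<close> is locally a unit of
  the valuation ring.\<close>

lemma sections_divide_power:
  assumes a: "a \<in> sections Z" and b: "b \<in> sections Z" and sub: "\<And>x. b x = 0 \<Longrightarrow> a x = 0"
  obtains n where "0 < n" "(\<lambda>x. a x ^ n / b x) \<in> sections Z"
proof -
  have "\<exists>B. \<forall>c\<in>range b - {0}. \<forall>p. v p c \<le> B"
  proof -
    have "\<forall>c\<in>range b - {0}. \<exists>B. \<forall>p. v p c \<le> B"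
      using v_bounded by blast
    then obtain B where B: "\<forall>c\<in>range b - {0}. \<forall>p. v p c \<le> B c"
      by metis
    have fin: "finite (B ` (range b - {0}))"
      using constructible_finite_range[OF sectionsD(1)[OF b]] by simp
    have "\<forall>c\<in>range b - {0}. \<forall>p. v p c \<le> Max (B ` (range b - {0}))"
      using B Max_ge[OF fin] by (meson imageI order_trans)
    then show ?thesis by blast
  qed
  then obtain B where B: "\<And>x p. b x \<noteq> 0 \<Longrightarrow> v p (b x) \<le> B"
    by auto
  \<comment> \<open>The maximum with 0 keeps the exponent positive and larger than \<open>B\<close>
    even if \<open>B\<close> is negative.\<close>
  define n where "n = nat (max 0 B) + 1"
  have n: "0 < n" "B < int n"
    by (auto simp: n_def)
  have "(\<lambda>x. a x ^ n / b x) \<in> sections Z"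
    unfolding sections_def
  proof (intro CollectI conjI ballI)
    show "constructible Z (\<lambda>x. a x ^ n / b x)"
      by (rule constructible_binop) (use sectionsD(1) a b in auto)
    fix p assume p: "p \<in> topspace Z"
    note K = sectionsD(2)[OF a p] sectionsD(2)[OF b p]
    show "a p ^ n / b p \<in> K p"
    proof (cases "a p = 0")
      case True
      then show ?thesis using n(1) K_zero by (simp add: zero_power)
    next
      case False
      then show ?thesis
        unfolding divide_inverse by (intro K_mult K_power K_inverse K)
    qed
    obtain N where N: "openin Z N" "p \<in> N" "\<And>x. x \<in> N \<Longrightarrow> vge p 1 (a x - a p)"
      "\<And>x. x \<in> N \<Longrightarrow> vge p 1 (b x - b p)"
      using continuous_at2E[OF sectionsD(3)[OF a p] sectionsD(3)[OF b p]] by metis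
    show "continuous_at Z (\<lambda>x. a x ^ n / b x) p"
    proof (rule continuous_atI[OF N(1,2)])
      fix x assume x: "x \<in> N"
      show "vge p 1 (a x ^ n / b x - a p ^ n / b p)"
      proof (cases "b p = 0")
        \<comment> \<open>Division by zero gives 0, so the quotient has value 0 at \<open>p\<close>,
          and only its valuation at nearby \<open>x\<close> matters. That valuation is at least
          \<open>n - B\<close> if \<open>a x\<close> is nonzero.\<close>
        case True
        show ?thesis
        proof (cases "a x = 0")
          case False
          then have "b x \<noteq> 0" using sub by blast
          have "a p = 0" using True sub by blast
          then have "1 \<le> v p (a x)"
            using N(3)[OF x] False by (simp add: vge_def)
          then have "int n * 1 \<le> int n * v p (a x)"
            by (intro mult_left_mono) auto
          then have "1 \<le> v p (a x ^ n / b x)"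
            using False \<open>b x \<noteq> 0\<close> B[of x p] n(2)
            by (simp add: divide_inverse v_mult v_inverse v_power)
          then show ?thesis
            using True by (simp add: vge_def)
        qed (use True n(1) in \<open>simp add: zero_power\<close>)
      next
        case False
        note nb = near_nonzero[OF K(2) N(4)[OF x] False]
        \<comment> \<open>The product estimate wants a factor of non-negative valuation, so this
          property of the powers is carried through the induction.\<close>
        have pow: "vge p 1 (a x ^ k - a p ^ k) \<and> vge p 0 (a x ^ k)" for k
        proof (induction k)
          case 0
          then show ?case by (simp add: vge_def v_one)
        next
          case (Suc k)
          have "vge p (0 + 1) (a x * (a x ^ k - a p ^ k))"
            using vge_mult[OF vge_near[OF K(1) N(3)[OF x]]] Suc by blast
          moreover have "vge p 0 (a p ^ k)"
            using vge_diff[of p 0 "a x ^ k" "a x ^ k - a p ^ k"] Suc vge_mono[of p 1 _ 0] by simp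
          then have "vge p (0 + 1) (a p ^ k * (a x - a p))"
            using vge_mult N(3)[OF x] by blast
          ultimately have "vge p 1 (a x * (a x ^ k - a p ^ k) + a p ^ k * (a x - a p))"
            using vge_add by simp
          moreover have "vge p (0 + 0) (a x * a x ^ k)"
            using vge_mult[OF vge_near[OF K(1) N(3)[OF x]]] Suc by blast
          ultimately show ?case
            by (simp add: algebra_simps)
        qed
        \<comment> \<open>Both \<open>b x\<close> and \<open>b p\<close> have valuation 0, so the
          common denominator of the difference is a unit and it suffices to estimate the
          numerator.\<close>
        have inv: "vge p 0 (inverse (b x * b p))"
          using nb False v_K[OF K(2) False] by (simp add: vge_def v_mult v_inverse)
        have "vge p (0 + 1) (b p * (a x ^ n - a p ^ n))"
          using vge_mult[OF vge_K[OF K(2)]] pow by blast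
        moreover have "vge p 0 (a p ^ n)"
          using vge_diff[of p 0 "a x ^ n" "a x ^ n - a p ^ n"] pow vge_mono[of p 1 _ 0] by simp
        then have "vge p (0 + 1) (a p ^ n * (b x - b p))"
          using vge_mult N(4)[OF x] by blast
        ultimately have "vge p 1 (b p * (a x ^ n - a p ^ n) - a p ^ n * (b x - b p))"
          using vge_diff by simp
        from vge_mult[OF inv this]
        have "vge p 1 (inverse (b x * b p) * (b p * (a x ^ n - a p ^ n) - a p ^ n * (b x - b p)))"
          by simp
        also have "inverse (b x * b p) * (b p * (a x ^ n - a p ^ n) - a p ^ n * (b x - b p))
            = a x ^ n / b x - a p ^ n / b p"
          using nb(1) False by (simp add: field_simps)
        finally show ?thesis .
      qed
    qed
  qed
  then show ?thesis
    using that n(1) by blast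
qed

text \<open>The pointwise operations are transported along an injection \<open>e\<close>, so that
  the ring lives in a prescribed type; \<open>inv_into UNIV e\<close> decodes its elements.\<close>

definition section_ring :: "(('a \<Rightarrow> 'k) \<Rightarrow> 'r) \<Rightarrow> 'a topology \<Rightarrow> 'r ring" where
  "section_ring e Z = \<lparr>carrier = e ` sections Z,
     monoid.mult = (\<lambda>a b. e (\<lambda>x. inv_into UNIV e a x * inv_into UNIV e b x)),
     one = e (\<lambda>x. 0),
     ring.zero = e (\<lambda>x. 0),
     add = (\<lambda>a b. e (\<lambda>x. inv_into UNIV e a x + inv_into UNIV e b x))\<rparr>"

lemma section_ring_simps:
  assumes "inj e"
  shows "carrier (section_ring e Z) = e ` sections Z"
    and "\<zero>\<^bsub>section_ring e Z\<^esub> = e (\<lambda>x. 0)"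
    and "e f \<oplus>\<^bsub>section_ring e Z\<^esub> e g = e (\<lambda>x. f x + g x)"
    and "e f \<otimes>\<^bsub>section_ring e Z\<^esub> e g = e (\<lambda>x. f x * g x)"
  using assms by (simp_all add: section_ring_def)

lemma comm_rng_section_ring:
  assumes e: "inj e" shows "comm_rng (section_ring e Z)"
proof (intro comm_rng.intro abelian_groupI comm_rng_axioms.intro)
  note s = section_ring_simps[OF e, of Z]
  fix a assume "a \<in> carrier (section_ring e Z)"
  then obtain f where f: "f \<in> sections Z" "a = e f"
    by (auto simp: s)
  then show "\<exists>b\<in>carrier (section_ring e Z). b \<oplus>\<^bsub>section_ring e Z\<^esub> a = \<zero>\<^bsub>section_ring e Z\<^esub>"
    by (auto simp: s intro!: bexI[OF _ sections_uminus[OF f(1)]])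
qed (auto simp: section_ring_simps[OF e] sections_zero sections_add sections_mult algebra_simps)

lemma minus_section_ring:
  assumes e: "inj e" and f: "f \<in> sections Z"
  shows "\<ominus>\<^bsub>section_ring e Z\<^esub> e f = e (\<lambda>x. - f x)"
proof -
  interpret comm_rng "section_ring e Z"
    by (rule comm_rng_section_ring[OF e])
  show ?thesis
    by (rule minus_equality)
      (use f sections_uminus[OF f] in \<open>auto simp: section_ring_simps[OF e]\<close>)
qed

section \<open>Prime ideals of the ring of sections\<close>

definition point_ideal :: "(('a \<Rightarrow> 'k) \<Rightarrow> 'r) \<Rightarrow> 'a topology \<Rightarrow> 'a \<Rightarrow> 'r set" where
  "point_ideal e Z p = e ` {f \<in> sections Z. f p = 0}"

lemma mem_point_ideal_iff:
  "inj e \<Longrightarrow> f \<in> sections Z \<Longrightarrow> e f \<in> point_ideal e Z p \<longleftrightarrow> f p = 0"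
  by (auto simp: point_ideal_def inj_image_mem_iff)

lemma ex_bump_at:
  assumes Z: "coherent Z" and p: "p \<in> topspace Z"
  obtains f where "f \<in> sections Z" "f p \<noteq> 0"
  using coherent_basisE[OF Z openin_topspace p] sections_bump bump_nonzero_iff by metis

lemma rng_prime_ideal_point_ideal:
  assumes e: "inj e" and Z: "coherent Z" and p: "p \<in> topspace Z"
  shows "rng_prime_ideal (section_ring e Z) (point_ideal e Z p)"
proof -
  interpret comm_rng "section_ring e Z"
    by (rule comm_rng_section_ring[OF e])
  note s = section_ring_simps[OF e, of Z]
  have "rng_ideal (section_ring e Z) (point_ideal e Z p)"
    by (rule rng_idealI)
      (auto simp: point_ideal_def s minus_section_ring[OF e] sections_zero sections_add
         sections_mult sections_uminus)
  moreover obtain f where f: "f \<in> sections Z" "f p \<noteq> 0"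
    using ex_bump_at[OF Z p] .
  then have "point_ideal e Z p \<noteq> carrier (section_ring e Z)"
    using mem_point_ideal_iff[OF e f(1)] s(1) by auto
  ultimately show ?thesis
    unfolding rng_prime_ideal_def
    by (auto simp: s mem_point_ideal_iff[OF e] sections_mult)
qed

text \<open>Exponents start at 1: the constant function 1 need not be a section, so there is no
  zeroth power to begin with.\<close>

lemma section_power_notin_prime:
  assumes e: "inj e" and P: "rng_prime_ideal (section_ring e Z) P"
    and f: "f \<in> sections Z" "e f \<notin> P" and n: "0 < n"
  shows "(\<lambda>x. f x ^ n) \<in> sections Z \<and> e (\<lambda>x. f x ^ n) \<notin> P"
  using n
proof (induction n rule: nat_induct_non_zero)
  case 1
  then show ?case using f by simp
next
  case (Suc n)
  let ?g = "\<lambda>x. f x ^ n"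
  interpret comm_rng "section_ring e Z"
    by (rule comm_rng_section_ring[OF e])
  note s = section_ring_simps[OF e, of Z]
  have "e f \<otimes>\<^bsub>section_ring e Z\<^esub> e ?g \<notin> P"
    using rng_prime_idealD(3)[OF P, of "e f" "e ?g"] Suc f by (auto simp: s)
  then show ?case
    using sections_mult[OF f(1), of ?g] Suc by (simp add: s)
qed

text \<open>For suitable \<open>n\<close> the quotient \<open>f ^ n / g\<close> is a section, so
  \<open>f ^ n\<close> is a multiple of \<open>g\<close> and lies in \<open>P\<close>; primality
  descends to \<open>f\<close>.\<close>

lemma prime_closed_under_support:
  assumes e: "inj e" and P: "rng_prime_ideal (section_ring e Z) P"
    and f: "f \<in> sections Z" and g: "g \<in> sections Z" "e g \<in> P"
    and sub: "\<And>x. g x = 0 \<Longrightarrow> f x = 0"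
  shows "e f \<in> P"
proof (rule ccontr)
  assume nf: "e f \<notin> P"
  obtain n where n: "0 < n" "(\<lambda>x. f x ^ n / g x) \<in> sections Z"
    using sections_divide_power[OF f g(1) sub] .
  let ?q = "\<lambda>x. f x ^ n / g x"
  interpret comm_rng "section_ring e Z"
    by (rule comm_rng_section_ring[OF e])
  note s = section_ring_simps[OF e, of Z]
  have "e ?q \<otimes>\<^bsub>section_ring e Z\<^esub> e g \<in> P"
    using rng_idealD(5)[OF rng_prime_idealD(1)[OF P] g(2), of "e ?q"] n(2) by (simp add: s)
  moreover have "(\<lambda>x. ?q x * g x) = (\<lambda>x. f x ^ n)"
  proof
    fix x show "?q x * g x = f x ^ n"
      using sub[of x] n(1) by (cases "g x = 0") (simp_all add: zero_power)
  qed
  ultimately have "e (\<lambda>x. f x ^ n) \<in> P"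
    by (simp add: s)
  then show False
    using section_power_notin_prime[OF e P f nf n(1)] by blast
qed

lemma prime_directed:
  assumes e: "inj e" and P: "rng_prime_ideal (section_ring e Z) P"
    and f: "f \<in> sections Z" "e f \<in> P" and g: "g \<in> sections Z" "e g \<in> P"
  obtains h where "h \<in> sections Z" "e h \<in> P" "\<forall>x. h x = 0 \<longrightarrow> f x = 0 \<and> g x = 0"
proof -
  interpret comm_rng "section_ring e Z"
    by (rule comm_rng_section_ring[OF e])
  note s = section_ring_simps[OF e, of Z]
  note I = rng_idealD[OF rng_prime_idealD(1)[OF P]]
  obtain W where W: "openin Z W" "compactin Z W" "{x. g x \<noteq> 0} \<subseteq> W"
    using constructible_support_cover[OF sectionsD(1)[OF g(1)]] .
  \<comment> \<open>The coefficient \<open>t W\<close> is cut off to a compact open \<open>W\<close>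
    in order to be a section. On \<open>W\<close> the axiom \<open>squares\<close> applies; off
    \<open>W\<close> already \<open>g\<close> is 0 and \<open>h\<close> is the square of
    \<open>f\<close>.\<close>
  define h where "h = (\<lambda>x. f x * f x + bump W x * g x * g x)"
  note b = sections_mult[OF sections_bump[OF W(1,2)] g(1)]
  have h: "h \<in> sections Z"
    unfolding h_def by (intro sections_add sections_mult f g sections_bump W)
  have "e (\<lambda>x. f x * f x) \<in> P"
    using I(5)[OF f(2), of "e f"] f(1) by (simp add: s)
  moreover have "e (\<lambda>x. bump W x * g x * g x) \<in> P"
    using I(5)[OF g(2), of "e (\<lambda>x. bump W x * g x)"] b by (simp add: s)
  ultimately have "e h \<in> P"
    using I(3) unfolding h_def by (metis s(3))
  moreover have "f x = 0 \<and> g x = 0" if "h x = 0" for x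
  proof (cases "x \<in> W")
    case True
    then show ?thesis
      using that squares[of "f x" W "g x"] by (simp add: h_def bump_def mult.assoc)
  next
    case False
    then have "g x = 0" using W(3) by blast
    then show ?thesis using that by (simp add: h_def)
  qed
  ultimately show ?thesis
    using that h by blast
qed

lemma prime_finite_directed:
  assumes e: "inj e" and P: "rng_prime_ideal (section_ring e Z) P"
    and "finite G" "G \<subseteq> {g \<in> sections Z. e g \<in> P}"
  shows "\<exists>h \<in> sections Z. e h \<in> P \<and> (\<forall>g\<in>G. \<forall>x. h x = 0 \<longrightarrow> g x = 0)"
  using assms(3,4)
proof (induction G rule: finite_induct)
  case empty
  interpret comm_rng "section_ring e Z"
    by (rule comm_rng_section_ring[OF e])
  show ?case
    using rng_idealD(2)[OF rng_prime_idealD(1)[OF P]] sections_zero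
    by (auto simp: section_ring_simps[OF e])
next
  case (insert g G)
  then obtain h where h: "h \<in> sections Z" "e h \<in> P" "\<forall>g\<in>G. \<forall>x. h x = 0 \<longrightarrow> g x = 0"
    by auto
  have g: "g \<in> sections Z" "e g \<in> P"
    using insert.prems by auto
  obtain k where "k \<in> sections Z" "e k \<in> P" "\<forall>x. k x = 0 \<longrightarrow> g x = 0 \<and> h x = 0"
    by (rule prime_directed[OF e P g h(1,2)])
  then show ?case
    using h(3) by (intro bexI[of _ k]) auto
qed

text \<open>Otherwise the open supports of the members of \<open>P\<close> cover the compact support
  of \<open>f\<close>. Finitely many suffice, one \<open>h\<close> in \<open>P\<close> vanishes only
  where all of these do, and then \<open>f\<close> is in \<open>P\<close> by
  \<open>prime_closed_under_support\<close>.\<close>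

lemma prime_common_zero:
  assumes e: "inj e" and Z: "coherent Z" and P: "rng_prime_ideal (section_ring e Z) P"
    and f: "f \<in> sections Z" "e f \<notin> P"
  obtains x where "f x \<noteq> 0" "\<forall>g\<in>sections Z. e g \<in> P \<longrightarrow> g x = 0"
proof -
  have "\<exists>x. f x \<noteq> 0 \<and> (\<forall>g\<in>sections Z. e g \<in> P \<longrightarrow> g x = 0)"
  proof (rule ccontr)
    assume n: "\<not> ?thesis"
    let ?G = "{g \<in> sections Z. e g \<in> P}"
    let ?D = "\<lambda>g :: 'a \<Rightarrow> 'k. {x. g x \<noteq> 0}"
    have cover: "{x. f x \<noteq> 0} \<subseteq> \<Union>(?D ` ?G)"
      using n by auto
    have "\<exists>\<F>. finite \<F> \<and> \<F> \<subseteq> ?D ` ?G \<and> {x. f x \<noteq> 0} \<subseteq> \<Union>\<F>"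
      by (rule compactinD[OF constructible_support_compact[OF Z sectionsD(1)[OF f(1)]] _ cover])
        (auto simp: openin_section_support)
    then obtain \<F> where F: "finite \<F>" "\<F> \<subseteq> ?D ` ?G" "{x. f x \<noteq> 0} \<subseteq> \<Union>\<F>"
      by (elim exE conjE)
    then obtain G where G: "G \<subseteq> ?G" "finite G" "\<F> = ?D ` G"
      by (elim finite_subset_image[elim_format] exE conjE)
    obtain h where h: "h \<in> sections Z" "e h \<in> P" "\<forall>g\<in>G. \<forall>x. h x = 0 \<longrightarrow> g x = 0"
      using prime_finite_directed[OF e P G(2,1)] by blast
    have "e f \<in> P"
    proof (rule prime_closed_under_support[OF e P f(1) h(1,2)])
      fix x assume "h x = 0"
      then show "f x = 0"
        using h(3) F(3) G(3) by auto
    qed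
    then show False
      using f(2) by blast
  qed
  then show ?thesis
    using that by blast
qed

lemma prime_is_point_ideal:
  assumes e: "inj e" and Z: "coherent Z" "sober Z" and P: "rng_prime_ideal (section_ring e Z) P"
  obtains p where "p \<in> topspace Z" "P = point_ideal e Z p"
proof -
  interpret comm_rng "section_ring e Z"
    by (rule comm_rng_section_ring[OF e])
  note s = section_ring_simps[OF e, of Z]
  note I = rng_idealD[OF rng_prime_idealD(1)[OF P]]
  define F where "F = {x \<in> topspace Z. \<forall>g\<in>sections Z. e g \<in> P \<longrightarrow> g x = 0}"
  \<comment> \<open>\<open>F\<close> is the common zero set of \<open>P\<close>. A section vanishing
    on all of \<open>F\<close> lies in \<open>P\<close>, a Nullstellensatz that lets
    \<open>F\<close> determine \<open>P\<close>.\<close>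
  have meet: "\<exists>x\<in>F. f x \<noteq> 0" if f: "f \<in> sections Z" "e f \<notin> P" for f
  proof -
    obtain x where "f x \<noteq> 0" "\<forall>g\<in>sections Z. e g \<in> P \<longrightarrow> g x = 0"
      by (rule prime_common_zero[OF e Z(1) P f])
    then show ?thesis
      using section_support_subset[OF f(1)] by (auto simp: F_def)
  qed
  have "closedin Z F"
  proof -
    have "F = topspace Z - \<Union>((\<lambda>g. {x. g x \<noteq> 0}) ` {g \<in> sections Z. e g \<in> P})"
      by (auto simp: F_def)
    then show ?thesis
      using openin_section_support by auto
  qed
  have bump_notin: "e (bump U) \<notin> P" if "openin Z U" "compactin Z U" "x \<in> U" "x \<in> F" for U x
    using that sections_bump[OF that(1,2)] bump_nonzero_iff[of U x] unfolding F_def by auto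
  have "irreducible_closed Z F"
    unfolding irreducible_closed_def
  proof (intro conjI allI impI)
    show "closedin Z F" by fact
    have "\<exists>f\<in>sections Z. e f \<notin> P"
      using rng_prime_idealD(2)[OF P] I(1) by (auto simp: s)
    then show "F \<noteq> {}"
      using meet by blast
  next
    fix G H assume GH: "closedin Z G \<and> closedin Z H \<and> F = G \<union> H"
    show "F = G \<or> F = H"
    proof (rule ccontr)
      assume "\<not> ?thesis"
      then obtain x y where x: "x \<in> F" "x \<notin> G" and y: "y \<in> F" "y \<notin> H"
        using GH by blast
      have "openin Z (topspace Z - G)" "x \<in> topspace Z - G"
        using GH x by (auto simp: F_def)
      then obtain U where U: "openin Z U" "compactin Z U" "x \<in> U" "U \<subseteq> topspace Z - G"
        by (rule coherent_basisE[OF Z(1)])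
      have "openin Z (topspace Z - H)" "y \<in> topspace Z - H"
        using GH y by (auto simp: F_def)
      then obtain V where V: "openin Z V" "compactin Z V" "y \<in> V" "V \<subseteq> topspace Z - H"
        by (rule coherent_basisE[OF Z(1)])
      have S: "bump U \<in> sections Z" "bump V \<in> sections Z"
        using sections_bump U V by auto
      \<comment> \<open>Both bumps are nonzero at a point of \<open>F\<close>, so neither is in
        \<open>P\<close> and by primality their product is not. It is then nonzero at a point of
        \<open>F\<close> in both \<open>U\<close> and \<open>V\<close>, outside \<open>G\<close> and
        \<open>H\<close>.\<close>
      have "e (\<lambda>z. bump U z * bump V z) \<notin> P"
        using rng_prime_idealD(3)[OF P, of "e (bump U)" "e (bump V)"] S
          bump_notin[OF U(1-3) x(1)] bump_notin[OF V(1-3) y(1)] by (auto simp: s)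
      then obtain z where "z \<in> F" "bump U z * bump V z \<noteq> 0"
        using meet[OF sections_mult[OF S]] by blast
      then have "z \<in> F" "z \<in> U" "z \<in> V"
        using bump_nonzero_iff by auto
      then show False
        using U(4) V(4) GH by blast
    qed
  qed
  then obtain p where p: "p \<in> topspace Z" "F = Z closure_of {p}"
    using Z(2) unfolding sober_def by blast
  have "p \<in> F"
    using p by (simp add: in_closure_of)
  \<comment> \<open>Every open set meeting \<open>F\<close> contains the generic point
    \<open>p\<close>; applied to the support of \<open>f\<close>, this shows that a section
    vanishing at \<open>p\<close> vanishes on \<open>F\<close>.\<close>
  have "e f \<in> P \<longleftrightarrow> f p = 0" if f: "f \<in> sections Z" for f
  proof
    show "f p = 0" if "e f \<in> P"
      using \<open>p \<in> F\<close> that f by (auto simp: F_def)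
    show "e f \<in> P" if "f p = 0"
    proof (rule ccontr)
      assume "e f \<notin> P"
      then obtain x where "x \<in> F" "f x \<noteq> 0"
        using meet[OF f] by blast
      have "x \<in> Z closure_of {p}"
        using \<open>x \<in> F\<close> p(2) by simp
      then have "p \<in> {x. f x \<noteq> 0}"
        unfolding in_closure_of using openin_section_support[OF f] \<open>f x \<noteq> 0\<close>
        by (elim conjE allE[of _ "{x. f x \<noteq> 0}"]) auto
      then show False using that by simp
    qed
  qed
  then have "P = point_ideal e Z p"
    using I(1) by (fastforce simp: point_ideal_def s)
  then show ?thesis
    using that p(1) by blast
qed

section \<open>The homeomorphism with the prime spectrum\<close>

lemma basic_open_section_ring:
  assumes e: "inj e" and Z: "coherent Z" "sober Z" and f: "f \<in> sections Z"
  shows "basic_open (section_ring e Z) (e f) = point_ideal e Z ` {x. f x \<noteq> 0}"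
proof (intro subset_antisym subsetI)
  fix P assume "P \<in> basic_open (section_ring e Z) (e f)"
  then have P: "rng_prime_ideal (section_ring e Z) P" "e f \<notin> P"
    by (auto simp: basic_open_def)
  obtain p where "p \<in> topspace Z" "P = point_ideal e Z p"
    using prime_is_point_ideal[OF e Z P(1)] .
  then show "P \<in> point_ideal e Z ` {x. f x \<noteq> 0}"
    using P(2) mem_point_ideal_iff[OF e f] by auto
next
  fix P assume "P \<in> point_ideal e Z ` {x. f x \<noteq> 0}"
  then obtain x where x: "f x \<noteq> 0" "P = point_ideal e Z x" by blast
  then have "x \<in> topspace Z"
    using section_support_subset[OF f] by blast
  then show "P \<in> basic_open (section_ring e Z) (e f)"
    using rng_prime_ideal_point_ideal[OF e Z(1)] x mem_point_ideal_iff[OF e f]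
    by (simp add: basic_open_def)
qed

text \<open>Bumps on compact open sets detect membership in any open set, so equal point ideals
  force equal open neighbourhoods, and sober spaces are T0.\<close>

lemma inj_on_point_ideal:
  assumes e: "inj e" and Z: "coherent Z" "sober Z"
  shows "inj_on (point_ideal e Z) (topspace Z)"
proof (rule inj_onI)
  fix x y assume xy: "x \<in> topspace Z" "y \<in> topspace Z" "point_ideal e Z x = point_ideal e Z y"
  have zero: "f x = 0 \<longleftrightarrow> f y = 0" if "f \<in> sections Z" for f
    using mem_point_ideal_iff[OF e that] xy(3) by metis
  have sep: "y' \<in> W" if "\<And>f. f \<in> sections Z \<Longrightarrow> f x' = 0 \<longleftrightarrow> f y' = 0" "openin Z W" "x' \<in> W" for x' y' W
  proof -
    obtain U where "openin Z U" "compactin Z U" "x' \<in> U" "U \<subseteq> W"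
      using coherent_basisE[OF Z(1) \<open>openin Z W\<close> \<open>x' \<in> W\<close>] .
    then show ?thesis
      using that(1)[OF sections_bump] bump_nonzero_iff by blast
  qed
  show "x = y"
    by (rule sober_imp_T0[OF Z(2) xy(1,2)]) (use sep[of x y] sep[of y x] zero in blast)
qed

text \<open>Basic open sets pull back to supports of sections, which are open. Conversely the
  compact open sets form a basis of \<open>Z\<close> and, as supports of bumps, are carried onto
  basic open sets.\<close>

lemma homeomorphic_map_point_ideal:
  assumes e: "inj e" and Z: "coherent Z" "sober Z"
  shows "homeomorphic_map Z (prime_spectrum (section_ring e Z)) (point_ideal e Z)"
    (is "homeomorphic_map Z ?S ?h")
proof (rule bijective_open_imp_homeomorphic_map)
  interpret comm_rng "section_ring e Z"
    by (rule comm_rng_section_ring[OF e])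
  note s = section_ring_simps[OF e, of Z]
  have top: "topspace ?S = ?h ` topspace Z"
  proof (intro subset_antisym subsetI)
    fix P assume "P \<in> topspace ?S"
    then have "rng_prime_ideal (section_ring e Z) P"
      by (simp add: topspace_prime_spectrum)
    then obtain p where "p \<in> topspace Z" "P = ?h p"
      by (rule prime_is_point_ideal[OF e Z])
    then show "P \<in> ?h ` topspace Z"
      by blast
  next
    fix P assume "P \<in> ?h ` topspace Z"
    then show "P \<in> topspace ?S"
      using rng_prime_ideal_point_ideal[OF e Z(1)] by (auto simp: topspace_prime_spectrum)
  qed
  then show "?h ` topspace Z = topspace ?S" ..
  show "inj_on ?h (topspace Z)"
    by (rule inj_on_point_ideal[OF e Z])
  show "continuous_map Z ?S ?h"
    unfolding continuous_map_def
  proof (intro conjI allI impI)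
    show "?h \<in> topspace Z \<rightarrow> topspace ?S"
      using top by auto
    fix U assume U: "openin ?S U"
    show "openin Z {x \<in> topspace Z. ?h x \<in> U}"
    proof (subst openin_subopen, intro ballI)
      fix x assume x: "x \<in> {x \<in> topspace Z. ?h x \<in> U}"
      then obtain a where a: "a \<in> carrier (section_ring e Z)" "?h x \<in> basic_open (section_ring e Z) a"
        "basic_open (section_ring e Z) a \<subseteq> U"
        using prime_spectrum_openE[OF U, of "?h x"] by blast
      then obtain f where f: "f \<in> sections Z" "a = e f"
        by (auto simp: s)
      have "f x \<noteq> 0"
        using a(2) mem_point_ideal_iff[OF e f(1)] f(2) by (simp add: basic_open_def)
      moreover have "{x. f x \<noteq> 0} \<subseteq> {x \<in> topspace Z. ?h x \<in> U}"
        using a(3) section_support_subset[OF f(1)]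
        unfolding f(2) basic_open_section_ring[OF e Z f(1)] by blast
      ultimately show "\<exists>T. openin Z T \<and> x \<in> T \<and> T \<subseteq> {x \<in> topspace Z. ?h x \<in> U}"
        using openin_section_support[OF f(1)] by blast
    qed
  qed
  show "open_map Z ?S ?h"
    unfolding open_map_def
  proof (intro allI impI)
    fix W assume W: "openin Z W"
    show "openin ?S (?h ` W)"
    proof (subst openin_subopen, intro ballI)
      fix P assume "P \<in> ?h ` W"
      then obtain x where x: "x \<in> W" "P = ?h x" by blast
      obtain U where U: "openin Z U" "compactin Z U" "x \<in> U" "U \<subseteq> W"
        using coherent_basisE[OF Z(1) W x(1)] .
      note b = sections_bump[OF U(1,2)]
      have "basic_open (section_ring e Z) (e (bump U)) = ?h ` U"
        unfolding basic_open_section_ring[OF e Z b] bump_nonzero_iff by simp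
      moreover have "openin ?S (basic_open (section_ring e Z) (e (bump U)))"
        by (rule openin_basic_open) (simp add: s b)
      ultimately show "\<exists>T. openin ?S T \<and> P \<in> T \<and> T \<subseteq> ?h ` W"
        using U x by (intro exI[of _ "?h ` U"]) auto
    qed
  qed
qed

lemma up_spectral_imp_almost_spectral:
  fixes e :: "('a \<Rightarrow> 'k) \<Rightarrow> 'r" and Z :: "'a topology"
  assumes e: "inj e" and Z: "up_spectral Z"
  shows "almost_spectral TYPE('r) Z"
  unfolding almost_spectral_def
proof (intro exI conjI)
  show "comm_rng (section_ring e Z)"
    by (rule comm_rng_section_ring[OF e])
  show "Z homeomorphic_space prime_spectrum (section_ring e Z)"
    using Z by (intro homeomorphic_map_imp_homeomorphic_space[OF homeomorphic_map_point_ideal[OF e]])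
      (simp_all add: up_spectral_def)
qed

end

section \<open>Valuations on fields of rational functions\<close>

text \<open>\<open>w\<close> grades the monomials. Their translation-invariant linear order is
  independent of this grading and makes the polynomials an integral domain.\<close>

locale additive_weight =
  fixes w :: "'m::{ordered_cancel_comm_monoid_add,linorder} \<Rightarrow> nat"
  assumes weight_add: "w (a + b) = w a + w b"
begin

section \<open>Order of a polynomial with respect to a weight\<close>

lemma weight_zero: "w 0 = 0"
  using weight_add[of 0 0] by simp

definition pord :: "('m \<Rightarrow>\<^sub>0 int) \<Rightarrow> nat" where
  "pord f = Min (w ` Poly_Mapping.keys f)"

lemma pord_le: "m \<in> Poly_Mapping.keys f \<Longrightarrow> pord f \<le> w m"
  by (simp add: pord_def)

lemma pord_attained:
  assumes "f \<noteq> 0" obtains m where "m \<in> Poly_Mapping.keys f" "w m = pord f"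
proof -
  have "pord f \<in> w ` Poly_Mapping.keys f"
    unfolding pord_def by (rule Min_in) (use assms in auto)
  then show ?thesis using that by auto
qed

lemma pord_geI: "f \<noteq> 0 \<Longrightarrow> (\<And>m. m \<in> Poly_Mapping.keys f \<Longrightarrow> n \<le> w m) \<Longrightarrow> n \<le> pord f"
  by (metis pord_attained)

lemma pord_add:
  assumes "f + g \<noteq> 0" shows "min (pord f) (pord g) \<le> pord (f + g)"
proof (rule pord_geI[OF assms])
  fix m assume "m \<in> Poly_Mapping.keys (f + g)"
  then show "min (pord f) (pord g) \<le> w m"
    using keys_add[of f g] pord_le[of m f] pord_le[of m g] by (auto simp: min_le_iff_disj)
qed

text \<open>The initial form, that is, the homogeneous component of least weight.\<close>

definition lead :: "('m \<Rightarrow>\<^sub>0 int) \<Rightarrow> ('m \<Rightarrow>\<^sub>0 int)" where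
  "lead f = Poly_Mapping.mapp (\<lambda>m c. if w m = pord f then c else 0) f"

lemma keys_lead: "Poly_Mapping.keys (lead f) = {m \<in> Poly_Mapping.keys f. w m = pord f}"
  by (auto simp: lead_def in_keys_iff lookup_mapp when_def split: if_splits)

lemma keys_diff_lead: "Poly_Mapping.keys (f - lead f) = {m \<in> Poly_Mapping.keys f. w m \<noteq> pord f}"
  by (auto simp: lead_def in_keys_iff lookup_mapp when_def lookup_minus split: if_splits)

text \<open>The initial forms have a nonzero product, since there are no zero divisors. Every other
  contribution to \<open>f * g\<close> has strictly larger weight and cannot cancel a monomial of
  that product.\<close>

lemma pord_mult:
  assumes f: "f \<noteq> 0" and g: "g \<noteq> 0" shows "pord (f * g) = pord f + pord g"
proof (rule antisym)
  show "pord f + pord g \<le> pord (f * g)"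
  proof (rule pord_geI)
    fix m assume "m \<in> Poly_Mapping.keys (f * g)"
    then obtain a b where "m = a + b" "a \<in> Poly_Mapping.keys f" "b \<in> Poly_Mapping.keys g"
      using keys_mult[of f g] by blast
    then show "pord f + pord g \<le> w m"
      using pord_le[of a f] pord_le[of b g] by (simp add: weight_add)
  qed (use f g in simp)
next
  have nz: "lead h \<noteq> 0" if "h \<noteq> 0" for h
    using pord_attained[OF that] keys_lead[of h] keys_eq_empty by (metis (mono_tags, lifting) empty_iff mem_Collect_eq)
  then have "lead f * lead g \<noteq> 0"
    using f g by simp
  then obtain m where m: "m \<in> Poly_Mapping.keys (lead f * lead g)"
    by (metis keys_eq_empty ex_in_conv)
  then have wm: "w m = pord f + pord g"
    using keys_mult[of "lead f" "lead g"] by (auto simp: keys_lead weight_add)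
  have 1: "m \<notin> Poly_Mapping.keys ((f - lead f) * g)"
  proof
    assume "m \<in> Poly_Mapping.keys ((f - lead f) * g)"
    then obtain a b where ab: "m = a + b" "a \<in> Poly_Mapping.keys (f - lead f)" "b \<in> Poly_Mapping.keys g"
      using keys_mult[of "f - lead f" g] by blast
    then have "pord f < w a"
      using pord_le[of a f] by (auto simp: keys_diff_lead)
    then show False
      using ab pord_le[of b g] wm by (simp add: weight_add)
  qed
  have 2: "m \<notin> Poly_Mapping.keys (lead f * (g - lead g))"
  proof
    assume "m \<in> Poly_Mapping.keys (lead f * (g - lead g))"
    then obtain a b where ab: "m = a + b" "a \<in> Poly_Mapping.keys (lead f)" "b \<in> Poly_Mapping.keys (g - lead g)"
      using keys_mult[of "lead f" "g - lead g"] by blast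
    then have "pord g < w b"
      using pord_le[of b g] by (auto simp: keys_diff_lead)
    then show False
      using ab pord_le[of a f] wm by (auto simp: weight_add keys_lead)
  qed
  have "f * g = (f - lead f) * g + lead f * (g - lead g) + lead f * lead g"
    by (simp add: algebra_simps)
  then have "m \<in> Poly_Mapping.keys (f * g)"
    using m 1 2 by (simp add: in_keys_iff lookup_add)
  then show "pord (f * g) \<le> pord f + pord g"
    using pord_le wm by metis
qed

section \<open>Extension of the order to fractions\<close>

definition ford :: "('m \<Rightarrow>\<^sub>0 int) fract \<Rightarrow> int" where
  "ford q = (THE n. \<exists>f g. f \<noteq> 0 \<and> g \<noteq> 0 \<and> q = Fract f g \<and> n = int (pord f) - int (pord g))"

text \<open>Cross-multiplication and \<open>pord_mult\<close> show that the difference is the same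
  for all representations of a fraction.\<close>

lemma ford_Fract:
  assumes "f \<noteq> 0" "g \<noteq> 0" shows "ford (Fract f g) = int (pord f) - int (pord g)"
  unfolding ford_def
proof (rule the_equality)
  fix n assume "\<exists>f' g'. f' \<noteq> 0 \<and> g' \<noteq> 0 \<and> Fract f g = Fract f' g' \<and> n = int (pord f') - int (pord g')"
  then obtain f' g' where h: "f' \<noteq> 0" "g' \<noteq> 0" "f * g' = f' * g" "n = int (pord f') - int (pord g')"
    using assms by (auto simp: eq_fract)
  then have "pord f + pord g' = pord f' + pord g"
    using assms pord_mult by metis
  then show "n = int (pord f) - int (pord g)"
    using h(4) by linarith
qed (use assms in blast)

lemma ford_mult:
  assumes "x \<noteq> 0" "y \<noteq> 0" shows "ford (x * y) = ford x + ford y"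
  using assms
  by (cases x rule: Fract_cases_nonzero; cases y rule: Fract_cases_nonzero)
    (simp_all add: ford_Fract pord_mult)

lemma ford_add:
  assumes "x \<noteq> 0" "y \<noteq> 0" "x + y \<noteq> 0" shows "min (ford x) (ford y) \<le> ford (x + y)"
proof -
  obtain a b where x: "x = Fract a b" "b \<noteq> 0" "a \<noteq> 0"
    using assms(1) by (cases x rule: Fract_cases_nonzero) auto
  obtain c d where y: "y = Fract c d" "d \<noteq> 0" "c \<noteq> 0"
    using assms(2) by (cases y rule: Fract_cases_nonzero) auto
  have xy: "x + y = Fract (a * d + c * b) (b * d)"
    using x y by simp
  then have nz: "a * d + c * b \<noteq> 0"
    using assms(3) by (auto simp: fract_collapse)
  have "min (pord (a * d)) (pord (c * b)) \<le> pord (a * d + c * b)"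
    by (rule pord_add[OF nz])
  then show ?thesis
    using x y nz unfolding xy by (simp add: ford_Fract pord_mult)
qed

text \<open>The order of the denominator is non-negative and can only lower the value. The bound
  depends on a single monomial of the numerator.\<close>

lemma ford_le_weight: "m \<in> Poly_Mapping.keys f \<Longrightarrow> g \<noteq> 0 \<Longrightarrow> ford (Fract f g) \<le> int (w m)"
  using pord_le[of m f] by (cases "f = 0") (auto simp: ford_Fract)

text \<open>If \<open>w\<close> is the degree in certain indeterminates, this is the subfield
  generated by the remaining ones. Only some representation of the fraction has to avoid the
  former.\<close>

definition weight_zero_field :: "('m \<Rightarrow>\<^sub>0 int) fract set" where
  "weight_zero_field = {Fract f g | f g. g \<noteq> 0 \<and>
     (\<forall>m\<in>Poly_Mapping.keys f \<union> Poly_Mapping.keys g. w m = 0)}"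

lemma weight_zero_keys_mult:
  assumes "\<forall>m\<in>Poly_Mapping.keys f. w m = 0" "\<forall>m\<in>Poly_Mapping.keys g. w m = 0"
  shows "\<forall>m\<in>Poly_Mapping.keys (f * g). w m = 0"
  using keys_mult[of f g] assms by (fastforce simp: weight_add)

lemma weight_zero_keys_add:
  assumes "\<forall>m\<in>Poly_Mapping.keys f. w m = 0" "\<forall>m\<in>Poly_Mapping.keys g. w m = 0"
  shows "\<forall>m\<in>Poly_Mapping.keys (f + g). w m = 0"
  using keys_add[of f g] assms by blast

lemma weight_zero_fieldI:
  "g \<noteq> 0 \<Longrightarrow> \<forall>m\<in>Poly_Mapping.keys f. w m = 0 \<Longrightarrow> \<forall>m\<in>Poly_Mapping.keys g. w m = 0 \<Longrightarrow>
    Fract f g \<in> weight_zero_field"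
  unfolding weight_zero_field_def by blast

lemma weight_zero_fieldE:
  assumes "x \<in> weight_zero_field"
  obtains f g where "x = Fract f g" "g \<noteq> 0" "\<forall>m\<in>Poly_Mapping.keys f. w m = 0" "\<forall>m\<in>Poly_Mapping.keys g. w m = 0"
  using assms unfolding weight_zero_field_def by blast

lemma weight_zero_field_subfield:
  shows "0 \<in> weight_zero_field"
    and "x \<in> weight_zero_field \<Longrightarrow> y \<in> weight_zero_field \<Longrightarrow> x + y \<in> weight_zero_field"
    and "x \<in> weight_zero_field \<Longrightarrow> y \<in> weight_zero_field \<Longrightarrow> x * y \<in> weight_zero_field"
    and "x \<in> weight_zero_field \<Longrightarrow> - x \<in> weight_zero_field"
    and "x \<in> weight_zero_field \<Longrightarrow> inverse x \<in> weight_zero_field"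
proof -
  show zero: "0 \<in> weight_zero_field"
    unfolding Zero_fract_def by (rule weight_zero_fieldI) (auto simp: weight_zero)
  {
    assume "x \<in> weight_zero_field" "y \<in> weight_zero_field"
    then obtain a b c d
      where x: "x = Fract a b" "b \<noteq> 0" "\<forall>m\<in>Poly_Mapping.keys a. w m = 0" "\<forall>m\<in>Poly_Mapping.keys b. w m = 0"
        and y: "y = Fract c d" "d \<noteq> 0" "\<forall>m\<in>Poly_Mapping.keys c. w m = 0" "\<forall>m\<in>Poly_Mapping.keys d. w m = 0"
      by (metis weight_zero_fieldE)
    show "x + y \<in> weight_zero_field"
      unfolding x(1) y(1) add_fract[OF x(2) y(2)]
      by (intro weight_zero_fieldI weight_zero_keys_add weight_zero_keys_mult x y) (simp add: x y)
    show "x * y \<in> weight_zero_field"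
      unfolding x(1) y(1) mult_fract
      by (intro weight_zero_fieldI weight_zero_keys_mult x y) (simp add: x y)
  }
  show "- x \<in> weight_zero_field" if "x \<in> weight_zero_field"
  proof -
    obtain f g where fg: "x = Fract f g" "g \<noteq> 0" "\<forall>m\<in>Poly_Mapping.keys f. w m = 0"
      "\<forall>m\<in>Poly_Mapping.keys g. w m = 0"
      using \<open>x \<in> weight_zero_field\<close> by (elim weight_zero_fieldE)
    then show ?thesis
      by (auto intro: weight_zero_fieldI)
  qed
  show "inverse x \<in> weight_zero_field" if "x \<in> weight_zero_field"
  proof -
    obtain f g where fg: "x = Fract f g" "g \<noteq> 0" "\<forall>m\<in>Poly_Mapping.keys f. w m = 0"
      "\<forall>m\<in>Poly_Mapping.keys g. w m = 0"
      using \<open>x \<in> weight_zero_field\<close> by (elim weight_zero_fieldE)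
    then show ?thesis
      using zero by (cases "f = 0") (auto simp: fract_collapse weight_zero_fieldI)
  qed
qed

lemma ford_weight_zero_field:
  assumes "x \<in> weight_zero_field" "x \<noteq> 0" shows "ford x = 0"
proof -
  obtain f g where fg: "x = Fract f g" "g \<noteq> 0" "\<forall>m\<in>Poly_Mapping.keys f. w m = 0"
    "\<forall>m\<in>Poly_Mapping.keys g. w m = 0"
    using assms(1) by (elim weight_zero_fieldE)
  moreover have "f \<noteq> 0"
    using assms(2) fg by (auto simp: fract_collapse)
  moreover have "pord h = 0" if "h \<noteq> 0" "\<forall>m\<in>Poly_Mapping.keys h. w m = 0" for h
    using pord_attained[OF that(1)] that(2) by metis
  ultimately show ?thesis
    by (simp add: ford_Fract)
qed

end

section \<open>Indeterminates indexed by an arbitrary type, and partial degrees\<close>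

text \<open>Polynomial mappings form an integral domain only over linearly ordered monomials.\<close>

datatype 'a wo = Wo (unwo: 'a)

instantiation wo :: (type) linorder
begin

text \<open>The well-ordering theorem supplies a linear order on an arbitrary type.\<close>

definition wo_order :: "('a \<times> 'a) set" where
  "wo_order = (SOME r. well_order_on UNIV r)"

definition less_eq_wo :: "'a wo \<Rightarrow> 'a wo \<Rightarrow> bool" where
  "less_eq_wo x y \<longleftrightarrow> (unwo x, unwo y) \<in> wo_order"

definition less_wo :: "'a wo \<Rightarrow> 'a wo \<Rightarrow> bool" where
  "less_wo x y \<longleftrightarrow> x \<le> y \<and> \<not> y \<le> x"

instance
proof -
  have "well_order_on UNIV (wo_order :: ('a \<times> 'a) set)"
    unfolding wo_order_def by (rule someI_ex) (rule well_order_on)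
  then have lin: "linear_order (wo_order :: ('a \<times> 'a) set)"
    by (simp add: well_order_on_def)
  then have r: "refl (wo_order :: ('a \<times> 'a) set)" "trans (wo_order :: ('a \<times> 'a) set)"
    "antisym (wo_order :: ('a \<times> 'a) set)" "total (wo_order :: ('a \<times> 'a) set)"
    by (auto simp: order_on_defs)
  show "OFCLASS('a wo, linorder_class)"
  proof intro_classes
    fix x y z :: "'a wo"
    show "x < y \<longleftrightarrow> x \<le> y \<and> \<not> y \<le> x"
      by (simp add: less_wo_def)
    show "x \<le> x"
      using r(1) by (simp add: less_eq_wo_def refl_on_def)
    show "x \<le> y \<Longrightarrow> y \<le> z \<Longrightarrow> x \<le> z"
      using transD[OF r(2)] by (auto simp: less_eq_wo_def)
    show "x \<le> y \<Longrightarrow> y \<le> x \<Longrightarrow> x = y"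
      using antisymD[OF r(3)] by (auto simp: less_eq_wo_def intro: wo.expand)
    show "x \<le> y \<or> y \<le> x"
      using r(1,4) by (cases "unwo x = unwo y") (auto simp: less_eq_wo_def refl_on_def total_on_def)
  qed
qed

end

type_synonym 'a mon = "'a wo \<Rightarrow>\<^sub>0 nat"

definition deg_in :: "'a set \<Rightarrow> 'a mon \<Rightarrow> nat" where
  "deg_in S m = (\<Sum>k\<in>{k \<in> Poly_Mapping.keys m. unwo k \<in> S}. Poly_Mapping.lookup m k)"

lemma deg_in_superset:
  assumes "finite F" "Poly_Mapping.keys m \<subseteq> F"
  shows "deg_in S m = (\<Sum>k\<in>{k \<in> F. unwo k \<in> S}. Poly_Mapping.lookup m k)"
  unfolding deg_in_def
  by (rule sum.mono_neutral_left) (use assms in \<open>auto simp: in_keys_iff\<close>)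

lemma deg_in_add: "deg_in S (a + b) = deg_in S a + deg_in S b"
proof -
  let ?F = "Poly_Mapping.keys a \<union> Poly_Mapping.keys b"
  have "Poly_Mapping.keys (a + b) \<subseteq> ?F" by (rule keys_add)
  then show ?thesis
    by (simp add: deg_in_superset[of ?F] lookup_add sum.distrib)
qed

lemma deg_in_mono: "S \<subseteq> T \<Longrightarrow> deg_in S m \<le> deg_in T m"
  unfolding deg_in_def by (rule sum_mono2) auto

lemma deg_in_single: "deg_in S (Poly_Mapping.single (Wo u) n) = (if u \<in> S then n else 0)"
proof -
  have "{k. k = Wo u \<and> unwo k \<in> S} = (if u \<in> S then {Wo u} else {})"
    by auto
  then show ?thesis
    by (simp add: deg_in_def)
qed

definition indet :: "'a \<Rightarrow> ('a mon \<Rightarrow>\<^sub>0 int) fract" where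
  "indet u = Fract (Poly_Mapping.single (Poly_Mapping.single (Wo u) 1) 1) 1"

interpretation deg: additive_weight "deg_in S" for S
  by unfold_locales (rule deg_in_add)

lemma indet_nonzero: "indet u \<noteq> 0"
proof -
  have "Poly_Mapping.single (Poly_Mapping.single (Wo u) (1::nat)) (1::int) \<noteq> 0"
    by (metis lookup_single_eq lookup_zero zero_neq_one)
  then show ?thesis
    by (simp add: indet_def Zero_fract_def eq_fract)
qed

lemma ford_indet: "deg.ford S (indet u) = (if u \<in> S then 1 else 0)"
proof -
  have "Poly_Mapping.single (Poly_Mapping.single (Wo u) (1::nat)) (1::int) \<noteq> 0"
    by (metis lookup_single_eq lookup_zero zero_neq_one)
  then show ?thesis
    by (simp add: indet_def deg.ford_Fract deg.pord_def deg_in_single deg.weight_zero)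
qed

lemma indet_in_weight_zero_field: "u \<notin> S \<Longrightarrow> indet u \<in> deg.weight_zero_field S"
  unfolding indet_def by (rule deg.weight_zero_fieldI) (auto simp: deg_in_single deg.weight_zero)

text \<open>For any monomial \<open>m\<close> of a numerator, the degree of \<open>m\<close> in the
  indeterminates from \<open>S\<close> is at most its total degree, which does not depend on
  \<open>S\<close>.\<close>

lemma ford_bounded:
  assumes nz: "x \<noteq> 0" shows "\<exists>B. \<forall>S. deg.ford S x \<le> B"
proof -
  obtain f g where x: "x = Fract f g" "g \<noteq> 0" "f \<noteq> 0"
    using nz by (cases x rule: Fract_cases_nonzero) auto
  then obtain m where m: "m \<in> Poly_Mapping.keys f"
    by (metis keys_eq_empty ex_in_conv)
  have "deg.ford S x \<le> int (deg_in UNIV m)" for S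
    using deg.ford_le_weight[OF m x(2), of S] deg_in_mono[of S UNIV m] x(1) by simp
  then show ?thesis by blast
qed

text \<open>A parity argument: with respect to total degree a square has even order, and an
  indeterminate times a square has odd order.\<close>

lemma square_add_indet_square:
  assumes "x * x + indet u * (y * y) = 0" shows "x = 0 \<and> y = 0"
proof (rule ccontr)
  assume n: "\<not> (x = 0 \<and> y = 0)"
  have eq: "x * x = - (indet u * (y * y))"
    using assms by (simp add: eq_neg_iff_add_eq_0)
  have nz: "x \<noteq> 0" "y \<noteq> 0"
    using n eq indet_nonzero[of u] by auto
  let ?v = "deg.ford UNIV"
  \<comment> \<open>Squaring once more removes the sign; the parity obstruction becomes one modulo
    4.\<close>
  have "(x * x) * (x * x) = (indet u * (y * y)) * (indet u * (y * y))"
    using eq by simp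
  then have "?v ((x * x) * (x * x)) = ?v ((indet u * (y * y)) * (indet u * (y * y)))"
    by simp
  then have "4 * ?v x = 2 + 4 * ?v y"
    using nz indet_nonzero[of u] by (simp add: deg.ford_mult ford_indet)
  then show False by presburger
qed

text \<open>At \<open>p\<close> the indeterminates of sets containing \<open>p\<close> get weight 0
  and all others weight 1, as \<open>t_K\<close> and \<open>t_pos\<close> demand.\<close>

interpretation rational_functions: valued_field
  "\<lambda>p. deg.ford {U. p \<notin> U}" "\<lambda>p. deg.weight_zero_field {U. p \<notin> U}" indet
proof (unfold_locales, goal_cases)
  case (9 U)
  show ?case by (rule indet_nonzero)
next
  case (12 x)
  then show ?case using ford_bounded by blast
next
  case (13 x U y)
  then show ?case by (rule square_add_indet_square)
qed (simp_all add: deg.ford_mult deg.ford_add deg.weight_zero_field_subfield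
  deg.ford_weight_zero_field ford_indet indet_in_weight_zero_field)

section \<open>Cardinality of the ring\<close>

lemma ex_inj_pair:
  assumes "infinite (UNIV :: 'c set)" shows "\<exists>p :: 'c \<times> 'c \<Rightarrow> 'c. inj p"
  using ordIso_imp_ordLeq[OF card_of_Times_same_infinite[OF assms]]
  unfolding card_of_ordLeq[symmetric] by auto

lemma ex_inj_list:
  assumes inf: "infinite (UNIV :: 'c set)" and i: "inj (i :: 'b \<Rightarrow> 'c)"
  shows "\<exists>e :: 'b list \<Rightarrow> 'c. inj e"
proof -
  obtain p :: "'c \<times> 'c \<Rightarrow> 'c" where p: "inj p"
    using ex_inj_pair[OF inf] by blast
  obtain n :: "nat \<Rightarrow> 'c" where n: "inj n"
    using infinite_countable_subset[OF inf] by blast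
  define code where "code = rec_list (n 0) (\<lambda>x _ c. p (i x, c))"
  have code: "code [] = n 0" "code (x # xs) = p (i x, code xs)" for x xs
    by (simp_all add: code_def)
  \<comment> \<open>The code of the empty list may coincide with that of a longer list, so
    \<open>code\<close> separates only lists of equal length; the length is then recorded
    separately.\<close>
  have "xs = ys" if "length xs = length ys" "code xs = code ys" for xs ys
    using that
    by (induction xs ys rule: list_induct2) (auto simp: code dest: injD[OF p] injD[OF i])
  then have "inj (\<lambda>xs. p (n (length xs), code xs))"
    by (intro injI) (auto dest!: injD[OF p] injD[OF n])
  then show ?thesis by blast
qed

lemma ex_inj_poly_mapping:
  assumes inf: "infinite (UNIV :: 'c set)" and i: "inj (i :: 'b \<Rightarrow> 'c)" and j: "inj (j :: 'd::zero \<Rightarrow> 'c)"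
  shows "\<exists>e :: ('b \<Rightarrow>\<^sub>0 'd) \<Rightarrow> 'c. inj e"
proof -
  obtain p :: "'c \<times> 'c \<Rightarrow> 'c" where p: "inj p"
    using ex_inj_pair[OF inf] by blast
  have "inj (\<lambda>(x, y). p (i x, j y))"
    by (auto intro!: injI dest!: injD[OF p] injD[OF i] injD[OF j])
  then obtain l :: "('b \<times> 'd) list \<Rightarrow> 'c" where l: "inj l"
    using ex_inj_list[OF inf] by blast
  \<comment> \<open>A finitely supported function is determined by its graph over the support;
    listing this finite set reduces the claim to lists.\<close>
  define graph where "graph f = {(k, Poly_Mapping.lookup f k) |k. k \<in> Poly_Mapping.keys f}" for f :: "'b \<Rightarrow>\<^sub>0 'd"
  have "\<exists>xs. set xs = graph f" for f
    by (rule finite_list) (simp add: graph_def)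
  then obtain xs where xs: "\<And>f. set (xs f) = graph f"
    by metis
  have "inj xs"
  proof (rule injI, rule poly_mapping_eqI)
    fix f g k assume "xs f = xs g"
    then have "graph f = graph g" using xs by metis
    then have "k \<in> Poly_Mapping.keys f \<longleftrightarrow> k \<in> Poly_Mapping.keys g"
      "k \<in> Poly_Mapping.keys f \<Longrightarrow> Poly_Mapping.lookup f k = Poly_Mapping.lookup g k"
      unfolding graph_def by blast+
    then show "Poly_Mapping.lookup f k = Poly_Mapping.lookup g k"
      by (cases "k \<in> Poly_Mapping.keys f") (auto simp: in_keys_iff)
  qed
  then show ?thesis
    using inj_compose[OF l] by blast
qed

lemma ex_inj_fract:
  assumes inf: "infinite (UNIV :: 'c set)" and i: "inj (i :: 'b::idom \<Rightarrow> 'c)"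
  shows "\<exists>e :: 'b fract \<Rightarrow> 'c. inj e"
proof -
  obtain p :: "'c \<times> 'c \<Rightarrow> 'c" where p: "inj p"
    using ex_inj_pair[OF inf] by blast
  have "\<exists>a b. x = Fract a b" for x :: "'b fract"
    by (cases x) blast
  then obtain a b where ab: "\<And>x :: 'b fract. x = Fract (a x) (b x)"
    by metis
  have "inj (\<lambda>x. p (i (a x), i (b x)))"
    using p i ab by (intro injI) (metis injD prod.inject)
  then show ?thesis by blast
qed

text \<open>A function is encoded by its graph. Argument and value are both coded in
  \<open>('a + nat) set\<close> and paired inside this type, so the graph lies one power set higher,
  in \<open>'a large\<close>.\<close>

lemma ex_inj_fun_large:
  assumes i: "inj (i :: 'k \<Rightarrow> ('a + nat) set)"
  shows "\<exists>e :: ('a \<Rightarrow> 'k) \<Rightarrow> 'a large. inj e"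
proof -
  have "infinite (UNIV :: ('a + nat) set set)"
    using infinite_iff_countable_subset[of "UNIV :: ('a + nat) set set"]
    by (auto intro!: exI[of _ "\<lambda>n. {Inr n}"] injI)
  then obtain p :: "('a + nat) set \<times> ('a + nat) set \<Rightarrow> ('a + nat) set" where p: "inj p"
    using ex_inj_pair by blast
  have "inj (\<lambda>f. range (\<lambda>x. p ({Inl x}, i (f x))))"
  proof (intro injI ext)
    fix f g :: "'a \<Rightarrow> 'k" and x
    assume "range (\<lambda>x. p ({Inl x}, i (f x))) = range (\<lambda>x. p ({Inl x}, i (g x)))"
    moreover have "p ({Inl x}, i (f x)) \<in> range (\<lambda>x. p ({Inl x}, i (f x)))"
      by (rule rangeI)
    ultimately obtain y where "p ({Inl x}, i (f x)) = p ({Inl y}, i (g y))"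
      by auto
    from injD[OF p this] show "f x = g x"
      by (auto dest: injD[OF i])
  qed
  then show ?thesis by blast
qed

theorem theorem8:
  fixes Z :: "'a topology"
  shows "(up_spectral Z \<longleftrightarrow> almost_spectral TYPE('a large) Z) \<and>
         (almost_spectral TYPE('r) Z \<longrightarrow> up_spectral Z)"
proof -
  \<comment> \<open>The indeterminates are indexed by sets of points, so
    \<open>('a + nat) set\<close> is large enough for them and for the exponents and coefficients.
    Being infinite, it then accommodates monomials, polynomials and fractions in turn.\<close>
  have inf: "infinite (UNIV :: ('a + nat) set set)"
    using infinite_iff_countable_subset[of "UNIV :: ('a + nat) set set"]
    by (auto intro!: exI[of _ "\<lambda>n. {Inr n}"] injI)
  have nat: "inj (\<lambda>n :: nat. {Inr n} :: ('a + nat) set)"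
    by (auto intro: injI)
  have int: "inj (\<lambda>k :: int. {Inr (to_nat k)} :: ('a + nat) set)"
    by (auto intro: injI)
  have var: "inj (\<lambda>u :: 'a set wo. Inl ` unwo u :: ('a + nat) set)"
    by (rule injI) (simp add: inj_image_eq_iff wo.expand)
  obtain i\<^sub>1 :: "'a set mon \<Rightarrow> ('a + nat) set" where "inj i\<^sub>1"
    using ex_inj_poly_mapping[OF inf var nat] by blast
  then obtain i\<^sub>2 :: "('a set mon \<Rightarrow>\<^sub>0 int) \<Rightarrow> ('a + nat) set" where "inj i\<^sub>2"
    using ex_inj_poly_mapping[OF inf _ int] by blast
  then obtain i\<^sub>3 :: "('a set mon \<Rightarrow>\<^sub>0 int) fract \<Rightarrow> ('a + nat) set" where "inj i\<^sub>3"
    using ex_inj_fract[OF inf] by blast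
  then obtain e :: "('a \<Rightarrow> ('a set mon \<Rightarrow>\<^sub>0 int) fract) \<Rightarrow> 'a large" where "inj e"
    using ex_inj_fun_large by blast
  then have "almost_spectral TYPE('a large) Z" if "up_spectral Z"
    using rational_functions.up_spectral_imp_almost_spectral that by blast
  then show ?thesis
    by (intro conjI iffI impI) (simp, (erule almost_spectral_imp_up_spectral)+)
qed

end
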